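(* The following three statements hold. (1) Let $h = h_6 + R_7 \colon (\mathbf{R}^2,\mathbf{0}) \to (\mathbf{R},0)$ be a function-germ, where $h_6$ is a non-zero homogeneous harmonic polynomial of degree $6$ and $R_7$ is a function-germ with $\mathrm{ord}(R_7) \ge 7$. Then $h$ is right-equivalent, by a conformal diffeomorphism-germ, to $g_6 + \tilde{R}_7$ for some function-germ $\tilde{R}_7$ with $\mathrm{ord}(\tilde{R}_7) \ge 7$. (2) For any homogeneous polynomial $\rho_7$ of degree $7$ in $(x,y)$ and any function-germ $R_8$ with $\mathrm{ord}(R_8) \ge 8$, the germ $g_6 + \rho_7 + R_8$ is $\mathcal{R}_7$-equivalent to $g_6 + \frac{c_1}{7!}x^7 + \frac{c_2}{6!\,1!}x^6 y$, where $$c_1 = \frac{\partial}{\partial x}\Delta^3 \rho_7 \in \mathbf{R}, \qquad c_2 = \frac{\partial}{\partial y}\Delta^3 \rho_7 \in \mathbf{R}.$$ (3) For any homogeneous polynomials $\rho_7, \rho_8$ in $(x,y)$ of degrees $7$ and $8$ respectively, the germ $g_6 + \rho_7 + \rho_8$ is $\mathcal{R}_8$-equivalent to $g_6 + \rho_7 + \frac{c}{8!}x^8$, where $c = \Delta^4 \rho_8 \in \mathbf{R}$.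
   Context: All function-germs are germs at the origin of $C^\infty$ functions on $\mathbf{R}^2$ with coordinates $(x,y)$, vanishing at the origin. $g_6 = \mathrm{Im}\,(x+iy)^6$, where $i = \sqrt{-1}$. $\Delta = \frac{\partial^2}{\partial x^2} + \frac{\partial^2}{\partial y^2}$ is the Laplacian; a function $h$ is harmonic if $\Delta h = 0$. The order $\mathrm{ord}(R)$ of a germ $R$ at the origin is the lowest degree of a non-zero term in its Taylor series at $\mathbf{0}$ (and $+\infty$ if the Taylor series is zero). Two germs $h_1,h_2$ are right-equivalent if there is a $C^\infty$ diffeomorphism-germ $\tau \colon (\mathbf{R}^2,\mathbf{0}) \to (\mathbf{R}^2,\mathbf{0})$ with $h_1 \circ \tau = h_2$; they are right-equivalent by a conformal diffeomorphism-germ if $\tau$ can be taken conformal (its derivative at each point near $\mathbf{0}$ is a non-zero scalar multiple of an orthogonal map). The $k$-jet $j^k h(\mathbf{0})$ is the Taylor series of $h$ at the origin up to and including degree $k$. Two germs $h_1, h_2$ are $\mathcal{R}_k$-equivalent if there is a germ $\tilde{h}_2$ with $j^k \tilde{h}_2(\mathbf{0}) = j^k h_2(\mathbf{0})$ such that $h_1$ is right-equivalent to $\tilde{h}_2$. *)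

theory Defs
  imports "HOL-Analysis.Analysis" "HOL-Library.Extended_Nat"
begin

section \<open>Smooth maps\<close>

definition partial_deriv ::
  "'a::euclidean_space \<Rightarrow> ('a \<Rightarrow> 'b::real_normed_vector) \<Rightarrow> 'a \<Rightarrow> 'b" where
  "partial_deriv b f p = frechet_derivative f (at p) b"

text \<open>
  On an open set \<open>U\<close> this is the usual class of \<open>k\<close> times continuously differentiable maps.
\<close>

primrec Ck_on ::
  "nat \<Rightarrow> ('a::euclidean_space \<Rightarrow> 'b::real_normed_vector) \<Rightarrow> 'a set \<Rightarrow> bool" where
  "Ck_on 0 f U \<longleftrightarrow> continuous_on U f"
| "Ck_on (Suc k) f U \<longleftrightarrow>
     (\<forall>p\<in>U. f differentiable (at p)) \<and> (\<forall>b\<in>Basis. Ck_on k (partial_deriv b f) U)"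

definition smooth_on ::
  "('a::euclidean_space \<Rightarrow> 'b::real_normed_vector) \<Rightarrow> 'a set \<Rightarrow> bool" where
  "smooth_on f U \<longleftrightarrow> (\<forall>k. Ck_on k f U)"


section \<open>Germs at the origin of the plane\<close>

text \<open>
  A germ at the origin is given by a representative defined on the whole plane, of which only the
  restriction to small neighbourhoods of the origin matters. Equality of germs is eventual
  equality with respect to the filter \<open>nhds 0\<close>.
\<close>

definition function_germ :: "(real \<times> real \<Rightarrow> real) \<Rightarrow> bool" where
  "function_germ f \<longleftrightarrow> f 0 = 0 \<and> (\<exists>U. open U \<and> 0 \<in> U \<and> smooth_on f U)"

definition diffeo_germ :: "(real \<times> real \<Rightarrow> real \<times> real) \<Rightarrow> bool" where
  "diffeo_germ \<tau> \<longleftrightarrow> \<tau> 0 = 0 \<and>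
     (\<exists>U V \<sigma>. open U \<and> 0 \<in> U \<and> open V \<and> \<tau> ` U = V \<and> (\<forall>p\<in>U. \<sigma> (\<tau> p) = p) \<and>
        smooth_on \<tau> U \<and> smooth_on \<sigma> V)"

definition conformal_germ :: "(real \<times> real \<Rightarrow> real \<times> real) \<Rightarrow> bool" where
  "conformal_germ \<tau> \<longleftrightarrow>
     (\<forall>\<^sub>F p in nhds 0. \<exists>c A. c \<noteq> 0 \<and> orthogonal_transformation A \<and>
        (\<tau> has_derivative (\<lambda>v. c *\<^sub>R A v)) (at p))"

definition right_equivalent :: "(real \<times> real \<Rightarrow> real) \<Rightarrow> (real \<times> real \<Rightarrow> real) \<Rightarrow> bool" where
  "right_equivalent h1 h2 \<longleftrightarrow> (\<exists>\<tau>. diffeo_germ \<tau> \<and> (\<forall>\<^sub>F p in nhds 0. h1 (\<tau> p) = h2 p))"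

definition conformally_right_equivalent ::
  "(real \<times> real \<Rightarrow> real) \<Rightarrow> (real \<times> real \<Rightarrow> real) \<Rightarrow> bool" where
  "conformally_right_equivalent h1 h2 \<longleftrightarrow>
     (\<exists>\<tau>. diffeo_germ \<tau> \<and> conformal_germ \<tau> \<and> (\<forall>\<^sub>F p in nhds 0. h1 (\<tau> p) = h2 p))"


section \<open>Partial derivatives, Taylor series, order and jets\<close>

abbreviation partial_x :: "(real \<times> real \<Rightarrow> real) \<Rightarrow> real \<times> real \<Rightarrow> real" where
  "partial_x \<equiv> partial_deriv (1, 0)"

abbreviation partial_y :: "(real \<times> real \<Rightarrow> real) \<Rightarrow> real \<times> real \<Rightarrow> real" where
  "partial_y \<equiv> partial_deriv (0, 1)"

definition laplacian :: "(real \<times> real \<Rightarrow> real) \<Rightarrow> real \<times> real \<Rightarrow> real" where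
  "laplacian f p = partial_x (partial_x f) p + partial_y (partial_y f) p"

definition harmonic :: "(real \<times> real \<Rightarrow> real) \<Rightarrow> bool" where
  "harmonic f \<longleftrightarrow> (\<forall>p. laplacian f p = 0)"

text \<open>The coefficient of \<open>x ^ i * y ^ j\<close> in the Taylor series at the origin.\<close>

definition taylor_coeff :: "(real \<times> real \<Rightarrow> real) \<Rightarrow> nat \<Rightarrow> nat \<Rightarrow> real" where
  "taylor_coeff f i j = (partial_x ^^ i) ((partial_y ^^ j) f) 0 / (fact i * fact j)"

text \<open>Note that \<open>Inf {} = \<infinity>\<close> in \<open>enat\<close>.\<close>

definition germ_order :: "(real \<times> real \<Rightarrow> real) \<Rightarrow> enat" where
  "germ_order f = Inf {enat (i + j) | i j. taylor_coeff f i j \<noteq> 0}"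

text \<open>A jet is the family of coefficients of the truncated Taylor series.\<close>

definition jet :: "nat \<Rightarrow> (real \<times> real \<Rightarrow> real) \<Rightarrow> nat \<Rightarrow> nat \<Rightarrow> real" where
  "jet k f i j = (if i + j \<le> k then taylor_coeff f i j else 0)"

definition R_equivalent ::
  "nat \<Rightarrow> (real \<times> real \<Rightarrow> real) \<Rightarrow> (real \<times> real \<Rightarrow> real) \<Rightarrow> bool" where
  "R_equivalent k h1 h2 \<longleftrightarrow>
     (\<exists>h2'. function_germ h2' \<and> jet k h2' = jet k h2 \<and> right_equivalent h1 h2')"


section \<open>Homogeneous polynomials in two variables\<close>

definition homogeneous_poly :: "nat \<Rightarrow> (real \<times> real \<Rightarrow> real) \<Rightarrow> bool" where
  "homogeneous_poly d f \<longleftrightarrow> (\<exists>a. \<forall>x y. f (x, y) = (\<Sum>i\<le>d. a i * x ^ i * y ^ (d - i)))"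

definition g6 :: "real \<times> real \<Rightarrow> real" where
  "g6 = (\<lambda>(x, y). Im ((of_real x + \<i> * of_real y) ^ 6))"

end

theory Submission
  imports Defs "HOL-Library.Landau_Symbols"
begin

text \<open>
  A germ has order at least \<open>n\<close> iff it is \<open>O(\<bar>p\<bar> ^ n)\<close>, and two germs have the same \<open>k\<close>-jet iff their
  difference is \<open>O(\<bar>p\<bar> ^ (k + 1))\<close>; so jets can be compared by estimates, without the chain rule for
  higher derivatives. Identify the plane with the complex numbers. A harmonic form of degree \<open>6\<close> is \<open>Re (\<alpha> * z ^ 6)\<close>,
  and the linear map \<open>z \<mapsto> b * z\<close> with \<open>\<alpha> * b ^ 6 = - \<i>\<close> turns it into \<open>g6\<close>. For the other
  two statements substitute \<open>p + q(p)\<close> for \<open>p\<close>, where \<open>q\<close> is a homogeneous vector field of degree \<open>d\<close>: up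
  to higher order this adds \<open>\<nabla>g6 \<bullet> q\<close>, which ranges over the real parts of the span of
  \<open>z ^ (5 + d - j) * cnj z ^ j\<close> with \<open>j \<le> d\<close>. For \<open>d = 2\<close> and \<open>d = 3\<close> this is a complement of the monomials kept
  in the normal forms, and equals the kernel of \<open>\<nabla>\<Delta>\<^sup>3\<close> and \<open>\<Delta>\<^sup>4\<close> respectively.
\<close>

section \<open>Calculus of smooth maps\<close>

lemma partial_deriv_cong:
  assumes "open U" "p \<in> U" "\<And>q. q \<in> U \<Longrightarrow> f q = g q"
  shows "partial_deriv b f p = partial_deriv b g p"
proof -
  have "(f has_derivative f') (at p) \<longleftrightarrow> (g has_derivative f') (at p)" for f'
    using has_derivative_transform_within_open[OF _ assms(1,2)] assms(3) by metis
  then show ?thesis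
    by (simp add: partial_deriv_def frechet_derivative_def)
qed

lemma partial_deriv_eq:
  "(f has_derivative f') (at p) \<Longrightarrow> partial_deriv b f p = f' b"
  by (simp add: partial_deriv_def frechet_derivative_at [symmetric])

lemma has_derivative_partial_deriv:
  "f differentiable (at p) \<Longrightarrow> (f has_derivative (\<lambda>b. partial_deriv b f p)) (at p)"
  by (simp add: partial_deriv_def frechet_derivative_works)

lemma Ck_on_cong:
  assumes "open U" "\<And>p. p \<in> U \<Longrightarrow> f p = g p"
  shows "Ck_on k f U \<longleftrightarrow> Ck_on k g U"
  using assms(2)
proof (induction k arbitrary: f g)
  case 0
  then show ?case by (simp cong: continuous_on_cong)
next
  case (Suc k)
  have "f differentiable (at p) \<longleftrightarrow> g differentiable (at p)" if "p \<in> U" for p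
    unfolding differentiable_def
    using has_derivative_transform_within_open[OF _ assms(1) that] Suc.prems by metis
  moreover have "Ck_on k (partial_deriv b f) U \<longleftrightarrow> Ck_on k (partial_deriv b g) U" for b
    by (rule Suc.IH) (use partial_deriv_cong[OF assms(1)] Suc.prems in blast)
  ultimately show ?case by simp
qed

text \<open>\<open>Ck_on\<close> is defined through \<open>frechet_derivative\<close>. This rule
  accepts any explicit formula for the derivative, so the closure properties below follow by
  induction from the usual differentiation rules.\<close>

lemma Ck_on_SucI:
  assumes "open U" "\<And>p. p \<in> U \<Longrightarrow> (f has_derivative f' p) (at p)"
    "\<And>b. b \<in> Basis \<Longrightarrow> Ck_on k (\<lambda>p. f' p b) U"
  shows "Ck_on (Suc k) f U"
proof -
  have "Ck_on k (partial_deriv b f) U" if "b \<in> Basis" for b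
    using Ck_on_cong[OF assms(1), of "partial_deriv b f" "\<lambda>p. f' p b"]
      partial_deriv_eq[OF assms(2)] assms(3)[OF that] by blast
  then show ?thesis
    using assms(2) by (auto simp: differentiable_def)
qed

lemma Ck_on_imp_continuous_on: "Ck_on k f U \<Longrightarrow> continuous_on U f"
  by (cases k)
    (auto intro: continuous_at_imp_continuous_on differentiable_imp_continuous_within)

lemma Ck_on_SucD: "Ck_on (Suc k) f U \<Longrightarrow> Ck_on k f U"
proof (induction k arbitrary: f)
  case 0
  then show ?case using Ck_on_imp_continuous_on by fastforce
next
  case (Suc k)
  then show ?case
    by (metis Ck_on.simps(2))
qed

lemma Ck_on_Suc_has_derivative:
  "Ck_on (Suc k) f U \<Longrightarrow> p \<in> U \<Longrightarrow> (f has_derivative (\<lambda>b. partial_deriv b f p)) (at p)"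
  by (simp add: has_derivative_partial_deriv)

lemma Ck_on_subset: "Ck_on k f U \<Longrightarrow> V \<subseteq> U \<Longrightarrow> Ck_on k f V"
  by (induction k arbitrary: f) (auto intro: continuous_on_subset)

lemma Ck_on_const: "open U \<Longrightarrow> Ck_on k (\<lambda>p. c) U"
proof (induction k arbitrary: c)
  case (Suc k)
  show ?case
    by (rule Ck_on_SucI[where f' = "\<lambda>p v. 0"]) (use Suc in auto)
qed simp

lemma Ck_on_bounded_linear:
  assumes "bounded_linear h" "open U" "Ck_on k f U"
  shows "Ck_on k (\<lambda>p. h (f p)) U"
  using assms(3)
proof (induction k arbitrary: f)
  case 0
  then show ?case
    by (simp add: bounded_linear.continuous_on[OF assms(1)])
next
  case (Suc k)
  show ?case
    by (rule Ck_on_SucI[OF assms(2) bounded_linear.has_derivative[OF assms(1)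
          Ck_on_Suc_has_derivative[OF Suc.prems]]])
      (use Suc in auto)
qed

lemma Ck_on_linear:
  assumes "bounded_linear h" "open U"
  shows "Ck_on k h U"
proof (cases k)
  case 0
  then show ?thesis using assms by (simp add: linear_continuous_on)
next
  case (Suc m)
  have "Ck_on (Suc m) h U"
    by (rule Ck_on_SucI[where f' = "\<lambda>p. h"])
      (use assms in \<open>auto intro: Ck_on_const bounded_linear_imp_has_derivative\<close>)
  then show ?thesis using Suc by simp
qed

lemma Ck_on_add:
  assumes "open U" "Ck_on k f U" "Ck_on k g U"
  shows "Ck_on k (\<lambda>p. f p + g p) U"
  using assms(2,3)
proof (induction k arbitrary: f g)
  case 0
  then show ?case by (simp add: continuous_on_add)
next
  case (Suc k)
  show ?case
    by (rule Ck_on_SucI[OF assms(1) has_derivative_add[OF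
          Ck_on_Suc_has_derivative[OF Suc.prems(1)] Ck_on_Suc_has_derivative[OF Suc.prems(2)]]])
      (use Suc in auto)
qed

lemma Ck_on_sum:
  assumes "open U" "\<And>i. i \<in> I \<Longrightarrow> Ck_on k (f i) U"
  shows "Ck_on k (\<lambda>p. \<Sum>i\<in>I. f i p) U"
  using assms(2)
  by (induction I rule: infinite_finite_induct) (auto intro: Ck_on_const Ck_on_add assms(1))

text \<open>By the product rule the derivative is a sum of two products of the same kind, each
  pairing one factor with a derivative of the other. The induction therefore runs over all pairs,
  and \<open>Ck_on_SucD\<close> lowers the class of the undifferentiated factor.\<close>

lemma Ck_on_bounded_bilinear:
  assumes "bounded_bilinear mul" "open U" "Ck_on k f U" "Ck_on k g U"
  shows "Ck_on k (\<lambda>p. mul (f p) (g p)) U"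
  using assms(3,4)
proof (induction k arbitrary: f g)
  case 0
  then show ?case by (simp add: bounded_bilinear.continuous_on[OF assms(1)])
next
  case (Suc k)
  show ?case
    by (rule Ck_on_SucI[OF assms(2) bounded_bilinear.FDERIV[OF assms(1)
          Ck_on_Suc_has_derivative[OF Suc.prems(1)] Ck_on_Suc_has_derivative[OF Suc.prems(2)]]])
      (use Suc in \<open>auto intro!: Ck_on_add[OF assms(2)] simp: Ck_on_SucD\<close>)
qed

lemma Ck_on_Pair:
  assumes "open U" "Ck_on k f U" "Ck_on k g U"
  shows "Ck_on k (\<lambda>p. (f p, g p)) U"
  using assms(2,3)
proof (induction k arbitrary: f g)
  case 0
  then show ?case by (simp add: continuous_on_Pair)
next
  case (Suc k)
  show ?case
    by (rule Ck_on_SucI[OF assms(1) has_derivative_Pair[OF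
          Ck_on_Suc_has_derivative[OF Suc.prems(1)] Ck_on_Suc_has_derivative[OF Suc.prems(2)]]])
      (use Suc in auto)
qed

lemma Ck_on_inverse:
  fixes f :: "'a::euclidean_space \<Rightarrow> real"
  assumes "open U" "\<And>p. p \<in> U \<Longrightarrow> f p \<noteq> 0" "Ck_on k f U"
  shows "Ck_on k (\<lambda>p. inverse (f p)) U"
  using assms(3)
proof (induction k)
  case 0
  then show ?case using assms(2) by (simp add: continuous_on_inverse)
next
  case (Suc k)
  \<comment> \<open>The derivative of \<open>inverse f\<close> contains \<open>inverse f\<close>
    again; the induction hypothesis supplies its regularity at level \<open>k\<close>.\<close>
  have *: "Ck_on k (\<lambda>p. inverse (f p)) U"
    using Suc by (simp add: Ck_on_SucD)
  have D: "((\<lambda>p. inverse (f p)) has_derivative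
        (\<lambda>b. - (inverse (f p) * partial_deriv b f p * inverse (f p)))) (at p)"
    if "p \<in> U" for p
    using Deriv.has_derivative_inverse[OF assms(2)[OF that] Ck_on_Suc_has_derivative[OF Suc.prems that]] .
  show ?case
    by (rule Ck_on_SucI[OF assms(1) D])
      (use Suc * assms(1) in \<open>auto intro!: Ck_on_bounded_bilinear[OF bounded_bilinear_mult]
          Ck_on_bounded_linear[OF bounded_linear_minus[OF bounded_linear_ident]]\<close>)
qed

text \<open>The chain rule in coordinates expresses each partial derivative through compositions of
  \<open>partial_deriv c f\<close> with the same \<open>g\<close>. Hence the induction varies
  \<open>f\<close> and keeps \<open>g\<close> fixed.\<close>

lemma Ck_on_compose:
  fixes f :: "'b::euclidean_space \<Rightarrow> 'c::real_normed_vector"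
    and g :: "'a::euclidean_space \<Rightarrow> 'b"
  assumes "open U" "open V" "g ` U \<subseteq> V" "Ck_on k f V" "Ck_on k g U"
  shows "Ck_on k (\<lambda>p. f (g p)) U"
  using assms(4,5)
proof (induction k arbitrary: f)
  case 0
  then show ?case using assms(3) by (auto intro: continuous_on_compose2)
next
  case (Suc k)
  have D: "((\<lambda>p. f (g p)) has_derivative
      (\<lambda>b. \<Sum>c\<in>Basis. (partial_deriv b g p \<bullet> c) *\<^sub>R partial_deriv c f (g p))) (at p)"
    if "p \<in> U" for p
  proof -
    have gp: "g p \<in> V" using that assms(3) by blast
    note Df = Ck_on_Suc_has_derivative[OF Suc.prems(1) gp]
    have "partial_deriv v f (g p) = (\<Sum>c\<in>Basis. (v \<bullet> c) *\<^sub>R partial_deriv c f (g p))" for v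
    proof -
      note L = has_derivative_linear[OF Df]
      have "partial_deriv v f (g p) = partial_deriv (\<Sum>c\<in>Basis. (v \<bullet> c) *\<^sub>R c) f (g p)"
        by (simp add: euclidean_representation)
      also have "\<dots> = (\<Sum>c\<in>Basis. (v \<bullet> c) *\<^sub>R partial_deriv c f (g p))"
        using linear_sum[OF L, of "\<lambda>c. (v \<bullet> c) *\<^sub>R c" Basis] linear_scale[OF L] by simp
      finally show ?thesis .
    qed
    note this [of "partial_deriv b g p" for b]
    with has_derivative_compose[OF Ck_on_Suc_has_derivative[OF Suc.prems(2) that] Df]
    show ?thesis by (simp only:)
  qed
  show ?case
  proof (rule Ck_on_SucI[OF assms(1) D])
    fix b :: 'a assume "b \<in> Basis"
    then have "Ck_on k (\<lambda>p. partial_deriv b g p \<bullet> c) U" for c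
      using Suc.prems(2) assms(1) by (auto intro!: Ck_on_bounded_linear[OF bounded_linear_inner_left])
    moreover have "Ck_on k (\<lambda>p. partial_deriv c f (g p)) U" if "c \<in> Basis" for c
      using Suc.IH[of "partial_deriv c f"] Ck_on_SucD[OF Suc.prems(2)] Suc.prems(1) that by simp
    ultimately show "Ck_on k (\<lambda>p. \<Sum>c\<in>Basis. (partial_deriv b g p \<bullet> c) *\<^sub>R partial_deriv c f (g p)) U"
      by (intro Ck_on_sum Ck_on_bounded_bilinear[OF bounded_bilinear_scaleR] assms(1))
  qed
qed

section \<open>Closure rules for smooth maps\<close>

lemma smooth_on_subset: "smooth_on f U \<Longrightarrow> V \<subseteq> U \<Longrightarrow> smooth_on f V"
  unfolding smooth_on_def using Ck_on_subset by blast

lemma smooth_on_imp_continuous_on: "smooth_on f U \<Longrightarrow> continuous_on U f"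
  unfolding smooth_on_def using Ck_on_imp_continuous_on by blast

lemma smooth_on_has_derivative:
  "smooth_on f U \<Longrightarrow> p \<in> U \<Longrightarrow> (f has_derivative (\<lambda>b. partial_deriv b f p)) (at p)"
  unfolding smooth_on_def using Ck_on_Suc_has_derivative by blast

lemma smooth_on_partial_deriv:
  "smooth_on f U \<Longrightarrow> b \<in> Basis \<Longrightarrow> smooth_on (partial_deriv b f) U"
  unfolding smooth_on_def using Ck_on.simps(2) by blast

lemma smooth_on_partial_deriv_funpow:
  "smooth_on f U \<Longrightarrow> b \<in> Basis \<Longrightarrow> smooth_on ((partial_deriv b ^^ n) f) U"
  by (induction n) (auto intro: smooth_on_partial_deriv)

lemma smooth_on_const: "open U \<Longrightarrow> smooth_on (\<lambda>p. c) U"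
  by (simp add: smooth_on_def Ck_on_const)

lemma smooth_on_linear: "bounded_linear h \<Longrightarrow> open U \<Longrightarrow> smooth_on h U"
  by (simp add: smooth_on_def Ck_on_linear)

lemma smooth_on_add:
  "open U \<Longrightarrow> smooth_on f U \<Longrightarrow> smooth_on g U \<Longrightarrow> smooth_on (\<lambda>p. f p + g p) U"
  by (simp add: smooth_on_def Ck_on_add)

lemma smooth_on_sum:
  "open U \<Longrightarrow> (\<And>i. i \<in> I \<Longrightarrow> smooth_on (f i) U) \<Longrightarrow> smooth_on (\<lambda>p. \<Sum>i\<in>I. f i p) U"
  by (simp add: smooth_on_def Ck_on_sum)

lemma smooth_on_mult:
  fixes f g :: "'a::euclidean_space \<Rightarrow> 'b::real_normed_algebra"
  shows "open U \<Longrightarrow> smooth_on f U \<Longrightarrow> smooth_on g U \<Longrightarrow> smooth_on (\<lambda>p. f p * g p) U"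
  by (simp add: smooth_on_def Ck_on_bounded_bilinear[OF bounded_bilinear_mult])

lemma smooth_on_power:
  fixes f :: "'a::euclidean_space \<Rightarrow> 'b::real_normed_algebra_1"
  shows "open U \<Longrightarrow> smooth_on f U \<Longrightarrow> smooth_on (\<lambda>p. f p ^ n) U"
  by (induction n) (auto intro: smooth_on_const smooth_on_mult)

lemma smooth_on_Pair:
  "open U \<Longrightarrow> smooth_on f U \<Longrightarrow> smooth_on g U \<Longrightarrow> smooth_on (\<lambda>p. (f p, g p)) U"
  by (simp add: smooth_on_def Ck_on_Pair)

lemma smooth_on_compose:
  fixes f :: "'b::euclidean_space \<Rightarrow> 'c::real_normed_vector"
    and g :: "'a::euclidean_space \<Rightarrow> 'b"
  shows "open U \<Longrightarrow> open V \<Longrightarrow> g ` U \<subseteq> V \<Longrightarrow> smooth_on f V \<Longrightarrow> smooth_on g U \<Longrightarrow>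
    smooth_on (\<lambda>p. f (g p)) U"
  by (simp add: smooth_on_def Ck_on_compose)

lemmas smooth_on_intros = smooth_on_const smooth_on_add smooth_on_mult smooth_on_power
  smooth_on_sum smooth_on_Pair smooth_on_linear[OF bounded_linear_fst]
  smooth_on_linear[OF bounded_linear_snd]

section \<open>Local diffeomorphisms of the plane\<close>

text \<open>Cramer's rule, with \<open>D\<close> the determinant. The explicit formula shows that
  the entries of the inverse are rational in those of \<open>L\<close>, so regularity of a
  derivative carries over to its inverse.\<close>

lemma linear_bij_plane:
  fixes L :: "real \<times> real \<Rightarrow> real \<times> real"
  assumes "linear L" "bij L"
  defines "D \<equiv> fst (L (1, 0)) * snd (L (0, 1)) - snd (L (1, 0)) * fst (L (0, 1))"
  shows "D \<noteq> 0"
    and "inv L b =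
      ((fst b * snd (L (0, 1)) - snd b * fst (L (0, 1))) * inverse D,
       (fst (L (1, 0)) * snd b - snd (L (1, 0)) * fst b) * inverse D)"
proof -
  have L: "L (s, t) = s *\<^sub>R L (1, 0) + t *\<^sub>R L (0, 1)" for s t
  proof -
    have "L (s, t) = L (s *\<^sub>R (1, 0) + t *\<^sub>R (0, 1))" by simp
    also have "\<dots> = s *\<^sub>R L (1, 0) + t *\<^sub>R L (0, 1)"
      using assms(1) by (simp only: linear_add linear_scale)
    finally show ?thesis .
  qed
  have inj: "v = 0" if "L v = 0" for v
    using that assms(1,2) by (metis bij_is_inj linear_0 injD)
  show D: "D \<noteq> 0"
  proof
    assume "D = 0"
    \<comment> \<open>Up to sign these two vectors are the columns of the adjugate matrix, which a
      singular \<open>L\<close> sends to zero.\<close>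
    then have "L (snd (L (0, 1)), - snd (L (1, 0))) = 0" "L (fst (L (0, 1)), - fst (L (1, 0))) = 0"
      by (subst L, simp add: D_def prod_eq_iff algebra_simps)+
    from this[THEN inj] have "L (1, 0) = 0"
      by (auto simp: prod_eq_iff)
    from inj[OF this] show False by (simp add: zero_prod_def)
  qed
  let ?v = "((fst b * snd (L (0, 1)) - snd b * fst (L (0, 1))) * inverse D,
       (fst (L (1, 0)) * snd b - snd (L (1, 0)) * fst b) * inverse D)"
  have "L ?v = b"
  proof (rule prod_eqI)
    have "fst (L ?v) = fst b * (D * inverse D)"
      by (subst L) (simp add: D_def algebra_simps)
    then show "fst (L ?v) = fst b" using D by simp
    have "snd (L ?v) = snd b * (D * inverse D)"
      by (subst L) (simp add: D_def algebra_simps)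
    then show "snd (L ?v) = snd b" using D by simp
  qed
  then show "inv L b = ?v"
    using assms(2) by (metis bij_inv_eq_iff)
qed

text \<open>The inverse function theorem gives a differentiable local inverse \<open>g\<close> whose
  derivative at \<open>y\<close> inverts that of \<tau> at \<open>g y\<close>. Smoothness follows by
  bootstrapping: if \<open>g\<close> is of class \<open>k\<close>, then by Cramer's rule so is its
  derivative, and \<open>g\<close> is of class \<open>k + 1\<close>.\<close>

lemma diffeo_germI:
  fixes \<tau> :: "real \<times> real \<Rightarrow> real \<times> real"
  assumes "open U" "0 \<in> U" "smooth_on \<tau> U" "\<tau> 0 = 0" "(\<tau> has_derivative (\<lambda>v. v)) (at 0)"
  shows "diffeo_germ \<tau>"
proof -
  \<comment> \<open>The inverse function theorem wants the derivative as a continuous map into the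
    bounded linear maps; continuity is checked on basis vectors.\<close>
  define T where "T p = Blinfun (\<lambda>b. partial_deriv b \<tau> p)" for p
  note D = smooth_on_has_derivative[OF assms(3)]
  have T: "blinfun_apply (T p) = (\<lambda>b. partial_deriv b \<tau> p)" if "p \<in> U" for p
    unfolding T_def using D[OF that] by (simp add: bounded_linear_Blinfun_apply has_derivative_bounded_linear)
  have DT: "(\<tau> has_derivative blinfun_apply (T p)) (at p)" if "p \<in> U" for p
    using D[OF that] by (simp only: T[OF that])
  have cont: "continuous_on U T"
  proof (rule continuous_on_blinfun_componentwise)
    fix i :: "real \<times> real" assume "i \<in> Basis"
    then have "continuous_on U (\<lambda>p. partial_deriv i \<tau> p)"
      using smooth_on_imp_continuous_on smooth_on_partial_deriv assms(3) by blast
    then show "continuous_on U (\<lambda>p. blinfun_apply (T p) i)"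
      by (rule continuous_on_eq) (simp add: T)
  qed
  have inv: "id_blinfun o\<^sub>L T 0 = id_blinfun"
    by (rule blinfun_eqI) (simp add: T assms(2) partial_deriv_eq[OF assms(5)])
  obtain U' V g g' where U': "open U'" "U' \<subseteq> U" "0 \<in> U'" "open V"
      "homeomorphism U' V \<tau> g"
    and g: "\<And>y. y \<in> V \<Longrightarrow> (g has_derivative (g' y)) (at y)"
      "\<And>y. y \<in> V \<Longrightarrow> g' y = inv (blinfun_apply (T (g y)))"
      "\<And>y. y \<in> V \<Longrightarrow> bij (blinfun_apply (T (g y)))"
    using inverse_function_theorem[OF assms(1) DT cont assms(2) inv] by metis
  have gV: "g ` V \<subseteq> U" using U' by (auto simp: homeomorphism_def)
  have "Ck_on k g V" for k
  proof (induction k)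
    case 0
    then show ?case using U' by (simp add: homeomorphism_def)
  next
    case (Suc k)
    define X where "X y = partial_deriv (1, 0) \<tau> (g y)" for y
    define Y where "Y y = partial_deriv (0, 1) \<tau> (g y)" for y
    have "Ck_on k (\<lambda>y. partial_deriv b \<tau> (g y)) V" if "b \<in> Basis" for b
      using Ck_on_compose[OF \<open>open V\<close> assms(1) gV] Suc that assms(3)
      by (metis Ck_on.simps(2) smooth_on_def)
    then have XY: "Ck_on k X V" "Ck_on k Y V"
      unfolding X_def Y_def by (auto simp: Basis_prod_def)
    have bij: "linear (\<lambda>b. partial_deriv b \<tau> (g y))" "bij (\<lambda>b. partial_deriv b \<tau> (g y))"
      if "y \<in> V" for y
      using g(3)[OF that] T[of "g y"] gV that D[of "g y"] by (auto intro: has_derivative_linear)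
    \<comment> \<open>\<open>d\<close> is the Jacobian determinant along \<open>g\<close>, and
      \<open>G b y\<close> is the inverse Jacobian applied to \<open>b\<close>. Differences are
      written as sums so that the closure rules in \<open>intros\<close> apply.\<close>
    define d where "d y = fst (X y) * snd (Y y) + (- 1) * (snd (X y) * fst (Y y))" for y
    define G where "G b y = ((fst b * snd (Y y) + (- snd b) * fst (Y y)) * inverse (d y),
       (snd b * fst (X y) + (- fst b) * snd (X y)) * inverse (d y))" for b :: "real \<times> real" and y
    have d: "d y \<noteq> 0" if "y \<in> V" for y
      using linear_bij_plane(1)[OF bij[OF that]] by (simp add: d_def X_def Y_def)
    have G: "g' y = (\<lambda>b. G b y)" if "y \<in> V" for y
    proof
      fix b
      have "g y \<in> U" using that gV by blast
      then have "g' y b = inv (\<lambda>b. partial_deriv b \<tau> (g y)) b"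
        by (simp add: g(2)[OF that] T)
      also have "\<dots> = G b y"
        unfolding linear_bij_plane(2)[OF bij[OF that]] by (simp add: G_def d_def X_def Y_def mult.commute)
      finally show "g' y b = G b y" .
    qed
    note intros = Ck_on_Pair Ck_on_add Ck_on_bounded_bilinear[OF bounded_bilinear_mult]
      Ck_on_const Ck_on_inverse Ck_on_bounded_linear[OF bounded_linear_fst]
      Ck_on_bounded_linear[OF bounded_linear_snd]
    have Cd: "Ck_on k d V"
      unfolding d_def by (intro intros XY \<open>open V\<close>)
    show ?case
    proof (rule Ck_on_SucI[OF \<open>open V\<close>])
      show "(g has_derivative (\<lambda>b. G b y)) (at y)" if "y \<in> V" for y
        using g(1)[OF that] by (simp only: G[OF that])
      show "Ck_on k (\<lambda>y. G b y) V" for b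
        unfolding G_def by (intro intros XY \<open>open V\<close> Cd d)
    qed
  qed
  then have "smooth_on g V" by (simp add: smooth_on_def)
  moreover have "smooth_on \<tau> U'" using assms(3) U'(2) by (rule smooth_on_subset)
  moreover have "\<tau> ` U' = V" "\<forall>p\<in>U'. g (\<tau> p) = p"
    using U' by (auto simp: homeomorphism_def)
  ultimately show ?thesis
    unfolding diffeo_germ_def using U' assms(4) by blast
qed

section \<open>Taylor polynomials and order of vanishing\<close>

text \<open>The filter is \<open>nhds 0\<close> rather than \<open>at 0\<close>: for positive
  \<open>n\<close> the estimate then also forces the value at the origin to be zero.\<close>

abbreviation vanishing :: "nat \<Rightarrow> (real \<times> real \<Rightarrow> real) set" where
  "vanishing n \<equiv> O[nhds 0](\<lambda>p. norm p ^ n)"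

lemma vanishing_mult: "f \<in> vanishing m \<Longrightarrow> g \<in> vanishing n \<Longrightarrow> (\<lambda>p. f p * g p) \<in> vanishing (m + n)"
  by (simp add: power_add landau_o.big.mult)

lemma vanishing_power: "f \<in> vanishing m \<Longrightarrow> (\<lambda>p. f p ^ n) \<in> vanishing (m * n)"
  using landau_o.big_power[of f "nhds 0" "\<lambda>p. norm p ^ m" n] by (simp add: power_mult)

lemma eventually_norm_le_1: "\<forall>\<^sub>F p in nhds (0::'a::real_normed_vector). norm p \<le> 1"
  unfolding eventually_nhds_metric by (intro exI[of _ 1]) (auto simp: dist_norm)

lemma vanishing_mono:
  assumes "f \<in> vanishing n" "m \<le> n"
  shows "f \<in> vanishing m"
proof -
  have "(\<lambda>p::real \<times> real. norm p ^ n) \<in> vanishing m"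
  proof (rule landau_o.bigI[of 1])
    show "\<forall>\<^sub>F p::real \<times> real in nhds 0. norm (norm p ^ n) \<le> 1 * norm (norm p ^ m)"
      by (rule eventually_mono[OF eventually_norm_le_1]) (auto intro: power_decreasing assms(2))
  qed simp
  then show ?thesis using assms(1) landau_o.big.trans by blast
qed

lemma fst_vanishing: "fst \<in> vanishing 1" and snd_vanishing: "snd \<in> vanishing 1"
proof -
  have "\<bar>fst p\<bar> \<le> norm p" "\<bar>snd p\<bar> \<le> norm p" for p :: "real \<times> real"
    using norm_fst_le[of "fst p" "snd p"] norm_snd_le[of "snd p" "fst p"] by simp_all
  then show "fst \<in> vanishing 1" "snd \<in> vanishing 1"
    by (auto intro!: landau_o.bigI[of 1] always_eventually simp del: split_paired_All)
qed

lemma const_vanishing: "(\<lambda>p. c) \<in> vanishing 0"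
  by simp

section \<open>Taylor's theorem in the plane\<close>

text \<open>Restriction to a horizontal line. With its vertical counterpart this reduces the
  expansion in the plane to the Maclaurin formula in one variable.\<close>

lemma partial_x_real_derivative:
  assumes "(f has_derivative f') (at (x, y))"
  shows "((\<lambda>s. f (s, y)) has_real_derivative partial_x f (x, y)) (at x)"
proof -
  have "((\<lambda>s. f (s, y)) has_derivative (\<lambda>s. f' (s, 0))) (at x)"
    by (rule has_derivative_compose[of "\<lambda>s. (s, y)" _ _ _ f, OF _ assms])
      (auto intro!: derivative_eq_intros)
  moreover have "(\<lambda>s. f' (s, 0)) = (*) (f' (1, 0))"
  proof
    fix s
    show "f' (s, 0) = f' (1, 0) * s"
      using linear_scale[OF has_derivative_linear[OF assms], of s "(1, 0)"] by simp
  qed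
  ultimately show ?thesis
    by (simp only: has_field_derivative_def partial_deriv_eq[OF assms])
qed

lemma partial_y_real_derivative:
  assumes "(f has_derivative f') (at (x, y))"
  shows "((\<lambda>s. f (x, s)) has_real_derivative partial_y f (x, y)) (at y)"
proof -
  have "((\<lambda>s. f (x, s)) has_derivative (\<lambda>s. f' (0, s))) (at y)"
    by (rule has_derivative_compose[of "\<lambda>s. (x, s)" _ _ _ f, OF _ assms])
      (auto intro!: derivative_eq_intros)
  moreover have "(\<lambda>s. f' (0, s)) = (*) (f' (0, 1))"
  proof
    fix s
    show "f' (0, s) = f' (0, 1) * s"
      using linear_scale[OF has_derivative_linear[OF assms], of s "(0, 1)"] by simp
  qed
  ultimately show ?thesis
    by (simp only: has_field_derivative_def partial_deriv_eq[OF assms])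
qed

text \<open>Successive expansion in the two variables groups the Taylor terms by the power of
  \<open>y\<close>; this regroups them by total degree.\<close>

lemma sum_triangle_diagonals:
  fixes g :: "nat \<Rightarrow> nat \<Rightarrow> 'a::comm_monoid_add"
  shows "(\<Sum>j<n. \<Sum>i<n - j. g i j) = (\<Sum>k<n. \<Sum>i\<le>k. g i (k - i))"
proof -
  have "(\<Sum>j<n. \<Sum>i<n - j. g i j) = (\<Sum>(j, i)\<in>Sigma {..<n} (\<lambda>j. {..<n - j}). g i j)"
    by (rule sum.Sigma) auto
  also have "\<dots> = (\<Sum>(i, j)\<in>{(i, j). i + j < n}. g i j)"
    by (rule sum.reindex_bij_witness[where i = "\<lambda>(i, j). (j, i)" and j = "\<lambda>(i, j). (j, i)"]) auto
  finally show ?thesis by (simp add: sum.triangle_reindex)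
qed

text \<open>First expand in \<open>y\<close> from the point \<open>(x, 0)\<close> up to order
  \<open>n\<close>, then expand the coefficient of \<open>y ^ j\<close> along the axis in
  \<open>x\<close> up to order \<open>n - j\<close>. The derivatives appear in the order used by
  \<open>taylor_coeff\<close>: those in \<open>y\<close> are taken first.\<close>

lemma taylor_remainder_vanishing:
  assumes "open U" "0 \<in> U" "smooth_on f U"
  shows "(\<lambda>p. f p - (\<Sum>k<n. \<Sum>i\<le>k. taylor_coeff f i (k - i) * fst p ^ i * snd p ^ (k - i)))
    \<in> vanishing n"
proof -
  define F where "F i j = (partial_x ^^ i) ((partial_y ^^ j) f)" for i j
  have F: "smooth_on (F i j) U" for i j
    unfolding F_def using assms(3)
    by (intro smooth_on_partial_deriv_funpow) (auto simp: Basis_prod_def)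
  have FS: "F (Suc i) j = partial_x (F i j)" "F 0 (Suc j) = partial_y (F 0 j)" for i j
    by (simp_all add: F_def)
  obtain e where e: "e > 0" "cball 0 e \<subseteq> U"
    using assms(1,2) open_contains_cball by blast
  \<comment> \<open>Every derivative is continuous, hence bounded on a compact ball; these bounds
    control the Lagrange remainders.\<close>
  have "\<exists>B. \<forall>p\<in>cball 0 e. \<bar>F i j p\<bar> \<le> B" for i j
  proof -
    have "compact (F i j ` cball 0 e)"
      using smooth_on_imp_continuous_on[OF F] e(2)
      by (intro compact_continuous_image) (auto intro: continuous_on_subset)
    then have "bounded (F i j ` cball 0 e)" by (rule compact_imp_bounded)
    then show ?thesis unfolding bounded_iff by auto
  qed
  then obtain B where B: "\<And>i j p. p \<in> cball 0 e \<Longrightarrow> \<bar>F i j p\<bar> \<le> B i j"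
    by metis
  have ev: "\<forall>\<^sub>F p::real \<times> real in nhds 0. p \<in> cball 0 e"
    unfolding eventually_nhds_metric using e(1) by (intro exI[of _ e]) (auto simp: dist_commute)
  have le: "\<bar>x\<bar> \<le> norm (x, y)" "\<bar>y\<bar> \<le> norm (x, y)" for x y :: real
    using norm_fst_le[of x y] norm_snd_le[of y x] by simp_all
  \<comment> \<open>The intermediate point of the Lagrange remainder must stay in the ball: here for
    the vertical expansion, next for the expansion along the axis.\<close>
  have segment: "(x, t) \<in> cball 0 e" if "\<bar>t\<bar> \<le> \<bar>y\<bar>" "(x, y) \<in> cball 0 e" for x y t :: real
  proof -
    have "norm (x, t) \<le> norm (x, y)"
      using that(1) by (simp add: norm_Pair abs_le_square_iff)
    then show ?thesis using that(2) by simp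
  qed
  have segment': "(s, 0::real) \<in> cball 0 e" if "\<bar>s\<bar> \<le> \<bar>x\<bar>" "(x, y) \<in> cball 0 e" for x y s :: real
  proof -
    have "norm (s, 0::real) = \<bar>s\<bar>" by (simp add: norm_Pair)
    also have "\<dots> \<le> norm (x, y)" by (rule order_trans[OF that(1) le(1)])
    finally show ?thesis using that(2) by simp
  qed
  have remainder: "\<bar>r / fact m * z ^ m\<bar> \<le> b * N ^ m"
    if "\<bar>r\<bar> \<le> b" "\<bar>z\<bar> \<le> N" for r b z N :: real and m
  proof -
    have "\<bar>r / fact m\<bar> \<le> \<bar>r\<bar> / 1"
      unfolding abs_divide by (intro divide_left_mono) auto
    then have "\<bar>r / fact m\<bar> * \<bar>z\<bar> ^ m \<le> b * N ^ m"
      using that by (intro mult_mono power_mono) auto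
    then show ?thesis by (simp add: abs_mult power_abs)
  qed
  have y: "(\<lambda>p. f p - (\<Sum>j<n. F 0 j (fst p, 0) / fact j * snd p ^ j)) \<in> vanishing n"
  \<comment> \<open>Adding 1 to the bound ensures a positive constant.\<close>
  proof (rule landau_o.bigI[of "\<bar>B 0 n\<bar> + 1"])
    show "\<forall>\<^sub>F p in nhds 0. norm (f p - (\<Sum>j<n. F 0 j (fst p, 0) / fact j * snd p ^ j))
        \<le> (\<bar>B 0 n\<bar> + 1) * norm (norm p ^ n)"
      using ev
    proof (rule eventually_mono)
      fix p :: "real \<times> real" assume p: "p \<in> cball 0 e"
      obtain x y where xy: "p = (x, y)" by force
      have "((\<lambda>s. F 0 m (x, s)) has_real_derivative F 0 (Suc m) (x, t)) (at t)"
        if "\<bar>t\<bar> \<le> \<bar>y\<bar>" for m t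
        unfolding FS using segment[OF that] p e(2) xy
        by (intro partial_y_real_derivative[OF smooth_on_has_derivative[OF F]]) auto
      then obtain t where t: "\<bar>t\<bar> \<le> \<bar>y\<bar>"
        "F 0 0 (x, y) = (\<Sum>m<n. F 0 m (x, 0) / fact m * y ^ m) + F 0 n (x, t) / fact n * y ^ n"
        using Maclaurin_bi_le[of "\<lambda>m t. F 0 m (x, t)" "\<lambda>t. F 0 0 (x, t)" n y] by auto
      have "\<bar>F 0 n (x, t) / fact n * y ^ n\<bar> \<le> (\<bar>B 0 n\<bar> + 1) * norm p ^ n"
        using B[OF segment[OF t(1)], of x 0 n] p xy le(2)[of y x] by (intro remainder) auto
      then show "norm (f p - (\<Sum>j<n. F 0 j (fst p, 0) / fact j * snd p ^ j))
          \<le> (\<bar>B 0 n\<bar> + 1) * norm (norm p ^ n)"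
        using t(2) by (simp add: xy F_def)
    qed
  qed auto
  have x: "(\<lambda>p. F 0 j (fst p, 0) - (\<Sum>i<n - j. F i j 0 / fact i * fst p ^ i)) \<in> vanishing (n - j)" for j
  proof (rule landau_o.bigI[of "\<bar>B (n - j) j\<bar> + 1"])
    show "\<forall>\<^sub>F p::real \<times> real in nhds 0. norm (F 0 j (fst p, 0) - (\<Sum>i<n - j. F i j 0 / fact i * fst p ^ i))
        \<le> (\<bar>B (n - j) j\<bar> + 1) * norm (norm p ^ (n - j))"
      using ev
    proof (rule eventually_mono)
      fix p :: "real \<times> real" assume p: "p \<in> cball 0 e"
      obtain x y where xy: "p = (x, y)" by force
      have "((\<lambda>s. F m j (s, 0)) has_real_derivative F (Suc m) j (t, 0)) (at t)"
        if "\<bar>t\<bar> \<le> \<bar>x\<bar>" for m t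
        unfolding FS using segment'[OF that] p e(2) xy
        by (intro partial_x_real_derivative[OF smooth_on_has_derivative[OF F]]) auto
      then obtain t where t: "\<bar>t\<bar> \<le> \<bar>x\<bar>"
        "F 0 j (x, 0) = (\<Sum>m<n - j. F m j (0, 0) / fact m * x ^ m)
          + F (n - j) j (t, 0) / fact (n - j) * x ^ (n - j)"
        using Maclaurin_bi_le[of "\<lambda>m t. F m j (t, 0)" "\<lambda>t. F 0 j (t, 0)" "n - j" x] by auto
      have "\<bar>F (n - j) j (t, 0) / fact (n - j) * x ^ (n - j)\<bar> \<le> (\<bar>B (n - j) j\<bar> + 1) * norm p ^ (n - j)"
        using B[OF segment'[OF t(1)], of y "n - j" j] p xy le(1)[of x y] by (intro remainder) auto
      then show "norm (F 0 j (fst p, 0) - (\<Sum>i<n - j. F i j 0 / fact i * fst p ^ i))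
          \<le> (\<bar>B (n - j) j\<bar> + 1) * norm (norm p ^ (n - j))"
        using t(2) by (simp add: xy zero_prod_def)
    qed
  qed auto
  \<comment> \<open>The error in the coefficient of \<open>y ^ j\<close> has order
    \<open>n - j\<close>, and the factor \<open>y ^ j\<close> restores order \<open>n\<close>.
    Adding this sum to the vertical remainder replaces the coefficients by their Taylor
    polynomials.\<close>
  have "(\<lambda>p. \<Sum>j<n. (F 0 j (fst p, 0) - (\<Sum>i<n - j. F i j 0 / fact i * fst p ^ i)) * (snd p ^ j * (1 / fact j)))
      \<in> vanishing n"
  proof (rule big_sum_in_bigo)
    fix j assume "j \<in> {..<n}"
    then have "n - j + (1 * j + 0) = n" by simp
    then show "(\<lambda>p. (F 0 j (fst p, 0) - (\<Sum>i<n - j. F i j 0 / fact i * fst p ^ i)) * (snd p ^ j * (1 / fact j)))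
      \<in> vanishing n"
      using vanishing_mult[OF x[of j] vanishing_mult[OF vanishing_power[OF snd_vanishing, of j]
            const_vanishing[of "1 / fact j"]]]
      by (simp only:)
  qed
  from sum_in_bigo(1)[OF y this]
  have "(\<lambda>p. f p - (\<Sum>j<n. F 0 j (fst p, 0) / fact j * snd p ^ j)
      + (\<Sum>j<n. (F 0 j (fst p, 0) - (\<Sum>i<n - j. F i j 0 / fact i * fst p ^ i)) * (snd p ^ j * (1 / fact j))))
    \<in> vanishing n" .
  moreover have "(F 0 j (fst p, 0) - (\<Sum>i<n - j. F i j 0 / fact i * fst p ^ i)) * (snd p ^ j * (1 / fact j))
      = F 0 j (fst p, 0) / fact j * snd p ^ j - (\<Sum>i<n - j. taylor_coeff f i j * fst p ^ i * snd p ^ j)"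
    for j and p :: "real \<times> real"
  proof -
    have "(\<Sum>i<n - j. F i j 0 / fact i * fst p ^ i) * (snd p ^ j * (1 / fact j))
        = (\<Sum>i<n - j. taylor_coeff f i j * fst p ^ i * snd p ^ j)"
      unfolding sum_distrib_right by (intro sum.cong) (simp_all add: taylor_coeff_def F_def)
    then show ?thesis by (simp only: left_diff_distrib) simp
  qed
  ultimately have "(\<lambda>p. f p - (\<Sum>j<n. \<Sum>i<n - j. taylor_coeff f i j * fst p ^ i * snd p ^ j)) \<in> vanishing n"
    by (simp only: sum_subtractf) simp
  then show ?thesis
    by (simp only: sum_triangle_diagonals)
qed

section \<open>Uniqueness of Taylor coefficients\<close>

text \<open>Letting \<open>t\<close> tend to 0 kills the constant term; dividing by \<open>t\<close>
  lowers both the degree and the order by one. The punctured filter \<open>at 0\<close> is what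
  permits the division.\<close>

lemma polynomial_bigo_imp_zero:
  fixes c :: "nat \<Rightarrow> real"
  assumes "(\<lambda>t. \<Sum>m<n. c m * t ^ m) \<in> O[at 0](\<lambda>t. t ^ n)" "m < n"
  shows "c m = 0"
  using assms
proof (induction n arbitrary: c m)
  case 0
  then show ?case by (simp only: not_less0)
next
  case (Suc n)
  let ?f = "\<lambda>t::real. \<Sum>m<Suc n. c m * t ^ m"
  have split: "?f t = c 0 + t * (\<Sum>m<n. c (Suc m) * t ^ m)" for t
    by (simp only: sum.lessThan_Suc_shift) (simp add: sum_distrib_left algebra_simps)
  have "(\<lambda>t::real. t ^ Suc n) \<in> o[at 0](\<lambda>_. 1)"
    by (rule smalloI_tendsto) (auto intro!: tendsto_eq_intros)
  with Suc.prems(1) have "?f \<in> o[at 0](\<lambda>_. 1)"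
    by (rule landau_o.big_small_trans)
  then have "(?f \<longlongrightarrow> 0) (at 0)"
    using smalloD_tendsto by fastforce
  moreover have "(?f \<longlongrightarrow> c 0) (at 0)"
    unfolding split by (auto intro!: tendsto_eq_intros)
  ultimately have c0: "c 0 = 0"
    using tendsto_unique trivial_limit_at by blast
  have "(\<lambda>t. t * (\<Sum>m<n. c (Suc m) * t ^ m)) \<in> O[at 0](\<lambda>t. t * t ^ n)"
    using Suc.prems(1) unfolding split c0 by simp
  then have "(\<lambda>t. \<Sum>m<n. c (Suc m) * t ^ m) \<in> O[at 0](\<lambda>t. t ^ n)"
    by (subst (asm) landau_o.big.mult_cancel_left) (auto simp: eventually_at_filter)
  from Suc.IH[OF this] have "c (Suc m) = 0" if "m < n" for m
    using that by blast
  with c0 Suc.prems(2) show ?case by (cases m) auto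
qed

text \<open>On the line \<open>t \<mapsto> (s * t, t)\<close> the part of degree \<open>k\<close>
  becomes its value at \<open>(s, 1)\<close> times \<open>t ^ k\<close>. The one-variable case shows
  that this value is zero for every \<open>s\<close>, so the coefficients vanish as those of a
  polynomial in \<open>s\<close>.\<close>

lemma plane_polynomial_vanishing_imp_zero:
  assumes "(\<lambda>p. \<Sum>k<n. \<Sum>i\<le>k. a i (k - i) * fst p ^ i * snd p ^ (k - i)) \<in> vanishing n" "i + j < n"
  shows "a i j = 0"
proof -
  have "(\<Sum>l\<le>i + j. a l (i + j - l) * s ^ l) = 0" for s :: real
  proof (rule polynomial_bigo_imp_zero[where n = n and m = "i + j"
        and c = "\<lambda>k. \<Sum>i\<le>k. a i (k - i) * s ^ i"])
    have lim: "filterlim (\<lambda>t. (s * t, t)) (nhds 0) (at 0)"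
      unfolding zero_prod_def by (intro tendsto_Pair tendsto_eq_intros) auto
    have "(\<lambda>t::real. norm (s * t, t) ^ n) \<in> O[at 0](\<lambda>t. t ^ n)"
    proof (rule landau_o.bigI[of "(\<bar>s\<bar> + 1) ^ n + 1"], simp add: add_nonneg_pos, intro always_eventually allI)
      fix t :: real
      have "norm (s * t, t) \<le> (\<bar>s\<bar> + 1) * \<bar>t\<bar>"
        using norm_Pair_le[of "s * t" t] by (simp add: abs_mult algebra_simps)
      then have "norm (s * t, t) ^ n \<le> (\<bar>s\<bar> + 1) ^ n * \<bar>t\<bar> ^ n"
        by (metis norm_ge_zero power_mono power_mult_distrib)
      then show "norm (norm (s * t, t) ^ n) \<le> ((\<bar>s\<bar> + 1) ^ n + 1) * norm (t ^ n)"
        by (simp add: power_abs algebra_simps add_increasing)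
    qed
    from landau_o.big.trans[OF landau_o.big.compose[OF assms(1) lim] this]
    have "(\<lambda>t. \<Sum>k<n. \<Sum>i\<le>k. a i (k - i) * (s * t) ^ i * t ^ (k - i)) \<in> O[at 0](\<lambda>t. t ^ n)"
      by simp
    moreover have "(\<Sum>i\<le>k. a i (k - i) * (s * t) ^ i * t ^ (k - i)) = (\<Sum>i\<le>k. a i (k - i) * s ^ i) * t ^ k"
      for k t
      unfolding sum_distrib_right
    proof (rule sum.cong[OF refl])
      fix i assume "i \<in> {..k}"
      then have "t ^ k = t ^ i * t ^ (k - i)"
        by (simp flip: power_add)
      then show "a i (k - i) * (s * t) ^ i * t ^ (k - i) = a i (k - i) * s ^ i * t ^ k"
        by (simp add: power_mult_distrib)
    qed
    ultimately show "(\<lambda>t. \<Sum>k<n. (\<Sum>i\<le>k. a i (k - i) * s ^ i) * t ^ k) \<in> O[at 0](\<lambda>t. t ^ n)"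
      by simp
  qed (rule assms(2))
  then have "\<forall>k\<le>i + j. a k (i + j - k) = 0"
    using polyfun_eq_0[of "\<lambda>k. a k (i + j - k)" "i + j"] by blast
  from this[rule_format, of i] show ?thesis by simp
qed

section \<open>Jets and order in terms of growth\<close>

lemma function_germ_taylor_remainder:
  assumes "function_germ f"
  shows "(\<lambda>p. f p - (\<Sum>k<n. \<Sum>i\<le>k. taylor_coeff f i (k - i) * fst p ^ i * snd p ^ (k - i)))
    \<in> vanishing n"
proof -
  obtain U where "open U" "0 \<in> U" "smooth_on f U"
    using assms unfolding function_germ_def by blast
  then show ?thesis by (rule taylor_remainder_vanishing)
qed

text \<open>The difference of the two Taylor polynomials is \<open>f - g\<close> up to the two
  remainders, hence of order \<open>n\<close>, and uniqueness applies.\<close>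

lemma taylor_coeff_eqI:
  assumes "function_germ f" "function_germ g" "(\<lambda>p. f p - g p) \<in> vanishing n" "i + j < n"
  shows "taylor_coeff f i j = taylor_coeff g i j"
proof -
  let ?T = "\<lambda>f p. \<Sum>k<n. \<Sum>i\<le>k. taylor_coeff f i (k - i) * fst p ^ i * snd p ^ (k - i)"
  note f = function_germ_taylor_remainder[OF assms(1), of n]
  note g = function_germ_taylor_remainder[OF assms(2), of n]
  have "(\<lambda>p. f p - g p - (f p - ?T f p) + (g p - ?T g p)) \<in> vanishing n"
    by (intro sum_in_bigo assms f g)
  moreover have "f p - g p - (f p - ?T f p) + (g p - ?T g p) = (\<Sum>k<n. \<Sum>i\<le>k.
      (taylor_coeff f i (k - i) - taylor_coeff g i (k - i)) * fst p ^ i * snd p ^ (k - i))" for p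
    by (simp add: sum_subtractf algebra_simps)
  ultimately have "(\<lambda>p. \<Sum>k<n. \<Sum>i\<le>k.
      (taylor_coeff f i (k - i) - taylor_coeff g i (k - i)) * fst p ^ i * snd p ^ (k - i)) \<in> vanishing n"
    by (simp only:)
  from plane_polynomial_vanishing_imp_zero[where a = "\<lambda>i j. taylor_coeff f i j - taylor_coeff g i j", OF this assms(4)]
  show ?thesis by simp
qed

lemma jet_eqI:
  assumes "function_germ f" "function_germ g" "(\<lambda>p. f p - g p) \<in> vanishing (Suc k)"
  shows "jet k f = jet k g"
proof (intro ext)
  fix i j
  show "jet k f i j = jet k g i j"
    using taylor_coeff_eqI[OF assms, of i j] by (simp add: jet_def)
qed

lemma germ_order_ge_iff_coeff:
  "enat n \<le> germ_order f \<longleftrightarrow> (\<forall>i j. i + j < n \<longrightarrow> taylor_coeff f i j = 0)"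
proof -
  have "enat n \<le> germ_order f \<longleftrightarrow> (\<forall>i j. taylor_coeff f i j \<noteq> 0 \<longrightarrow> enat n \<le> enat (i + j))"
    unfolding germ_order_def le_Inf_iff Ball_def mem_Collect_eq by metis
  then show ?thesis
    by (metis enat_ord_simps(1) not_less)
qed

text \<open>A germ differs from its Taylor polynomial of degree below \<open>n\<close> by a term of
  order \<open>n\<close>, so it has order \<open>n\<close> itself exactly when that polynomial is
  zero.\<close>

lemma germ_order_ge_iff:
  assumes "function_germ f"
  shows "enat n \<le> germ_order f \<longleftrightarrow> f \<in> vanishing n"
proof -
  let ?T = "\<lambda>p. \<Sum>k<n. \<Sum>i\<le>k. taylor_coeff f i (k - i) * fst p ^ i * snd p ^ (k - i)"
  note T = function_germ_taylor_remainder[OF assms, of n]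
  show ?thesis
  proof
    assume "enat n \<le> germ_order f"
    then have "?T p = 0" for p
      by (auto simp: germ_order_ge_iff_coeff intro!: sum.neutral)
    with T show "f \<in> vanishing n" by simp
  next
    assume "f \<in> vanishing n"
    from sum_in_bigo(2)[OF this T] have "?T \<in> vanishing n" by simp
    from plane_polynomial_vanishing_imp_zero[OF this] show "enat n \<le> germ_order f"
      by (simp add: germ_order_ge_iff_coeff)
  qed
qed

section \<open>Homogeneous polynomials\<close>

lemma vanishing_imp_zero:
  assumes "f \<in> vanishing n" "0 < n"
  shows "f 0 = 0"
proof -
  obtain c where "\<forall>\<^sub>F p in nhds 0. norm (f p) \<le> c * norm (norm p ^ n)"
    using landau_o.bigE[OF assms(1)] .
  from eventually_nhds_x_imp_x[OF this] assms(2) show ?thesis by (simp add: power_0_left)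
qed

lemma vanishing_tendsto:
  assumes "f \<in> vanishing (Suc n)"
  shows "(f \<longlongrightarrow> 0) (nhds 0)"
proof -
  have "(\<lambda>p::real \<times> real. norm p ^ Suc n) \<in> o[nhds 0](\<lambda>_. 1)"
    using tendsto_power[OF tendsto_norm_zero[OF filterlim_ident], of "Suc n"]
    by (intro smalloI_tendsto) auto
  then have "f \<in> o[nhds 0](\<lambda>_. 1)"
    using assms by (rule landau_o.big_small_trans[rotated])
  then show ?thesis using smalloD_tendsto by fastforce
qed

lemma vanishing_compose:
  assumes "R \<in> vanishing n" "f \<in> vanishing 1" "g \<in> vanishing 1"
  shows "(\<lambda>p. R (f p, g p)) \<in> vanishing n"
proof -
  have lim: "filterlim (\<lambda>p. (f p, g p)) (nhds 0) (nhds 0)"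
    unfolding zero_prod_def using assms(2,3) vanishing_tendsto[of _ 0]
    by (intro tendsto_Pair) (simp_all add: zero_prod_def)
  have "norm (f p, g p) \<le> \<bar>f p\<bar> + \<bar>g p\<bar>" for p
    using norm_Pair_le[of "f p" "g p"] by simp
  then have "(\<lambda>p. norm (f p, g p)) \<in> O[nhds 0](\<lambda>p. \<bar>f p\<bar> + \<bar>g p\<bar>)"
    by (intro landau_o.bigI[of 1] always_eventually allI) simp_all
  moreover have "(\<lambda>p. \<bar>f p\<bar> + \<bar>g p\<bar>) \<in> vanishing 1"
    using assms(2,3) by (intro sum_in_bigo) simp_all
  ultimately have "(\<lambda>p. norm (f p, g p)) \<in> vanishing 1"
    by (rule landau_o.big.trans)
  then have "(\<lambda>p. norm (f p, g p) ^ n) \<in> vanishing n"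
    using vanishing_power[of "\<lambda>p. norm (f p, g p)" 1 n] by simp
  with landau_o.big.compose[OF assms(1) lim] show ?thesis
    by (rule landau_o.big.trans)
qed

text \<open>A term of order 2 is small compared with \<open>norm p\<close>. This makes the
  coordinate changes used later tangent to the identity at the origin.\<close>

lemma vanishing_has_derivative_zero:
  assumes "u \<in> vanishing 2"
  shows "(u has_derivative (\<lambda>_. 0)) (at 0)"
proof -
  have "u 0 = 0" using vanishing_imp_zero[OF assms] by simp
  have "at 0 \<le> nhds (0 :: real \<times> real)" by (simp add: at_within_def)
  from landau_o.big.filter_mono[OF this assms]
  have "u \<in> O[at 0](\<lambda>p. norm p ^ 2)" .
  moreover have "(\<lambda>p::real \<times> real. norm p ^ 2) \<in> o[at 0](\<lambda>p. norm p)"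
  proof (rule smalloI_tendsto)
    have "(\<lambda>p::real \<times> real. norm p ^ 2 / norm p) = norm"
      by (simp add: fun_eq_iff power2_eq_square)
    then show "((\<lambda>p::real \<times> real. norm p ^ 2 / norm p) \<longlongrightarrow> 0) (at 0)"
      by (simp add: tendsto_norm_zero)
  qed (simp add: eventually_at_filter)
  ultimately have "u \<in> o[at 0](\<lambda>p. norm p)"
    by (rule landau_o.big_small_trans)
  then have "((\<lambda>p. norm (u p / norm p)) \<longlongrightarrow> 0) (at 0)"
    by (intro tendsto_norm_zero smalloD_tendsto)
  then show ?thesis
    using \<open>u 0 = 0\<close> by (simp add: has_derivative_at)
qed

text \<open>Replacing a factor \<open>x\<close> of order 1 by \<open>u\<close> of order
  \<open>l + 1\<close> gains \<open>l\<close> orders. The induction telescopes the difference of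
  powers one factor at a time.\<close>

lemma power_perturb_vanishing:
  assumes "x \<in> vanishing 1" "u \<in> vanishing (Suc l)"
  shows "(\<lambda>p. (x p + u p) ^ i - x p ^ i) \<in> vanishing (i + l)"
proof (induction i)
  case (Suc i)
  have "u \<in> vanishing 1" using assms(2) by (rule vanishing_mono) simp
  with assms(1) have "(\<lambda>p. x p + u p) \<in> vanishing 1" by (rule sum_in_bigo)
  from vanishing_mult[OF this Suc]
  have 1: "(\<lambda>p. (x p + u p) * ((x p + u p) ^ i - x p ^ i)) \<in> vanishing (Suc i + l)"
    by (simp only: add_Suc plus_1_eq_Suc)
  have "Suc l + 1 * i = Suc i + l" by simp
  with vanishing_mult[OF assms(2) vanishing_power[OF assms(1), of i]]
  have 2: "(\<lambda>p. u p * x p ^ i) \<in> vanishing (Suc i + l)"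
    by (simp only:)
  have "(x p + u p) ^ Suc i - x p ^ Suc i = (x p + u p) * ((x p + u p) ^ i - x p ^ i) + u p * x p ^ i" for p
    by (simp add: algebra_simps)
  then show ?case
    using sum_in_bigo(1)[OF 1 2] by (simp only:)
qed simp

section \<open>Forms given by their coefficients\<close>

text \<open>With the coefficient sequence explicit, differentiation becomes arithmetic on sequences.
  The index counts the power of \<open>x\<close>.\<close>

definition homog :: "nat \<Rightarrow> (nat \<Rightarrow> real) \<Rightarrow> real \<times> real \<Rightarrow> real" where
  "homog d a p = (\<Sum>i\<le>d. a i * fst p ^ i * snd p ^ (d - i))"

lemma homogeneous_poly_iff: "homogeneous_poly d f \<longleftrightarrow> (\<exists>a. f = homog d a)"
  by (auto simp: homogeneous_poly_def homog_def fun_eq_iff)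

lemma smooth_on_homog: "open U \<Longrightarrow> smooth_on (homog d a) U"
proof -
  assume "open U"
  then have "smooth_on (\<lambda>p. \<Sum>i\<le>d. a i * fst p ^ i * snd p ^ (d - i)) U"
    by (intro smooth_on_intros)
  then show ?thesis by (simp add: homog_def[abs_def])
qed

lemma homog_vanishing: "homog d a \<in> vanishing d"
proof -
  have "(\<lambda>p. \<Sum>i\<le>d. a i * fst p ^ i * snd p ^ (d - i)) \<in> vanishing d"
  proof (rule big_sum_in_bigo)
    fix i assume "i \<in> {..d}"
    then have "0 + 1 * i + 1 * (d - i) = d" by simp
    then show "(\<lambda>p. a i * fst p ^ i * snd p ^ (d - i)) \<in> vanishing d"
      using vanishing_mult[OF vanishing_mult[OF const_vanishing[of "a i"]
            vanishing_power[OF fst_vanishing, of i]] vanishing_power[OF snd_vanishing, of "d - i"]]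
      by (simp only:)
  qed
  then show ?thesis by (simp add: homog_def[abs_def])
qed

lemma function_germ_homog: "0 < d \<Longrightarrow> function_germ (homog d a)"
  unfolding function_germ_def
  by (auto simp: homog_def power_0_left intro!: sum.neutral exI[of _ UNIV] smooth_on_homog)

lemma homog_perturb_vanishing:
  assumes u: "u \<in> vanishing (Suc l)" and v: "v \<in> vanishing (Suc l)"
  shows "(\<lambda>p. homog d a (fst p + u p, snd p + v p) - homog d a p) \<in> vanishing (d + l)"
proof -
  have "(\<lambda>p. \<Sum>i\<le>d. a i * (((fst p + u p) ^ i - fst p ^ i) * (snd p + v p) ^ (d - i)
      + fst p ^ i * ((snd p + v p) ^ (d - i) - snd p ^ (d - i)))) \<in> vanishing (d + l)"
  proof (rule big_sum_in_bigo)
    fix i assume "i \<in> {..d}"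
    then have deg: "(i + l) + 1 * (d - i) = d + l" "1 * i + (d - i + l) = d + l" by simp_all
    have "v \<in> vanishing 1" using v by (rule vanishing_mono) simp
    then have "(\<lambda>p. snd p + v p) \<in> vanishing 1"
      by (rule sum_in_bigo(1)[OF snd_vanishing])
    from vanishing_mult[OF power_perturb_vanishing[OF fst_vanishing u, of i] vanishing_power[OF this, of "d - i"]]
    have 1: "(\<lambda>p. ((fst p + u p) ^ i - fst p ^ i) * (snd p + v p) ^ (d - i)) \<in> vanishing (d + l)"
      by (simp only: deg)
    from vanishing_mult[OF vanishing_power[OF fst_vanishing, of i] power_perturb_vanishing[OF snd_vanishing v, of "d - i"]]
    have 2: "(\<lambda>p. fst p ^ i * ((snd p + v p) ^ (d - i) - snd p ^ (d - i))) \<in> vanishing (d + l)"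
      by (simp only: deg)
    from vanishing_mult[OF const_vanishing[of "a i"] sum_in_bigo(1)[OF 1 2]]
    show "(\<lambda>p. a i * (((fst p + u p) ^ i - fst p ^ i) * (snd p + v p) ^ (d - i)
      + fst p ^ i * ((snd p + v p) ^ (d - i) - snd p ^ (d - i)))) \<in> vanishing (d + l)"
      by (simp only: add_0)
  qed
  moreover have "homog d a (fst p + u p, snd p + v p) - homog d a p =
    (\<Sum>i\<le>d. a i * (((fst p + u p) ^ i - fst p ^ i) * (snd p + v p) ^ (d - i)
      + fst p ^ i * ((snd p + v p) ^ (d - i) - snd p ^ (d - i))))" for p
    unfolding homog_def sum_subtractf[symmetric] by (intro sum.cong) (simp_all add: algebra_simps)
  ultimately show ?thesis by (simp only:)
qed

lemma homog_has_derivative: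
  "(homog d a has_derivative (\<lambda>h. \<Sum>i\<le>d. a i *
      (real i * fst p ^ (i - 1) * snd p ^ (d - i) * fst h
       + fst p ^ i * (real (d - i) * snd p ^ (d - i - 1)) * snd h))) (at p)"
proof -
  have "((\<lambda>p. \<Sum>i\<le>d. a i * fst p ^ i * snd p ^ (d - i)) has_derivative (\<lambda>h. \<Sum>i\<le>d. a i *
      (real i * fst p ^ (i - 1) * snd p ^ (d - i) * fst h
       + fst p ^ i * (real (d - i) * snd p ^ (d - i - 1)) * snd h))) (at p)"
    by (rule has_derivative_sum) (auto intro!: derivative_eq_intros simp: algebra_simps fun_eq_iff)
  then show ?thesis by (simp add: homog_def[abs_def])
qed

lemma partial_x_homog: "partial_x (homog (Suc d) a) = homog d (\<lambda>i. real (Suc i) * a (Suc i))"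
proof
  fix p
  show "partial_x (homog (Suc d) a) p = homog d (\<lambda>i. real (Suc i) * a (Suc i)) p"
    unfolding partial_deriv_eq[OF homog_has_derivative] sum.atMost_Suc_shift homog_def
    by (simp add: algebra_simps)
qed

lemma partial_y_homog: "partial_y (homog (Suc d) a) = homog d (\<lambda>i. real (Suc d - i) * a i)"
proof
  fix p
  have "(\<Sum>i\<le>d. a i * (fst p ^ i * (real (Suc d - i) * snd p ^ (Suc d - i - 1)))) =
      (\<Sum>i\<le>d. real (Suc d - i) * a i * fst p ^ i * snd p ^ (d - i))"
    by (intro sum.cong) auto
  then show "partial_y (homog (Suc d) a) p = homog d (\<lambda>i. real (Suc d - i) * a i) p"
    unfolding partial_deriv_eq[OF homog_has_derivative] sum.atMost_Suc homog_def by simp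
qed

text \<open>The Laplacian of a form is again given as a form, so powers of the Laplacian are
  computed by repeated rewriting.\<close>

lemma laplacian_homog:
  "laplacian (homog (Suc (Suc d)) a) = homog d (\<lambda>i. real (Suc i) * real (Suc (Suc i)) * a (Suc (Suc i))
     + real (Suc d - i) * real (Suc (Suc d) - i) * a i)"
proof
  fix p
  show "laplacian (homog (Suc (Suc d)) a) p =
      homog d (\<lambda>i. real (Suc i) * real (Suc (Suc i)) * a (Suc (Suc i))
        + real (Suc d - i) * real (Suc (Suc d) - i) * a i) p"
    unfolding laplacian_def partial_x_homog partial_y_homog
    unfolding homog_def sum.distrib[symmetric]
    by (intro sum.cong refl) (simp only: distrib_right mult.assoc)
qed

lemma homog_eq_zero_imp:
  assumes "\<And>p. homog d a p = 0" "i \<le> d"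
  shows "a i = 0"
proof -
  have "(\<Sum>i\<le>d. a i * s ^ i) = 0" for s
    using assms(1)[of "(s, 1)"] by (simp add: homog_def)
  with assms(2) show ?thesis using polyfun_eq_0[of a d] by blast
qed

lemma laplacian_homog_6:
  "laplacian (homog 6 a) = homog 4 (\<lambda>i. real (Suc i) * real (Suc (Suc i)) * a (Suc (Suc i))
     + real (5 - i) * real (6 - i) * a i)"
  using laplacian_homog[of 4 a] by simp

text \<open>The numbers come from the binomial expansion of the cube of the Laplacian: in the
  coefficient of \<open>x\<close> they are 7!, 3 * 5! * 2!, 3 * 3! * 4! and 6!, and symmetrically
  for \<open>y\<close>.\<close>

lemma laplacian3_homog_7:
  "(laplacian ^^ 3) (homog 7 a) = homog 1 (\<lambda>i. if i = 0
     then 720 * a 6 + 432 * a 4 + 720 * a 2 + 5040 * a 0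
     else 5040 * a 7 + 720 * a 5 + 432 * a 3 + 720 * a 1)"
proof
  fix p
  have "(laplacian ^^ 3) (homog 7 a) = laplacian (laplacian (laplacian (homog 7 a)))"
    by (simp add: eval_nat_numeral)
  then show "(laplacian ^^ 3) (homog 7 a) p = homog 1 (\<lambda>i. if i = 0
     then 720 * a 6 + 432 * a 4 + 720 * a 2 + 5040 * a 0
     else 5040 * a 7 + 720 * a 5 + 432 * a 3 + 720 * a 1) p"
    using laplacian_homog[of 5] laplacian_homog[of 3] laplacian_homog[of 1]
    by (simp add: homog_def eval_nat_numeral algebra_simps)
qed

lemma partial_x_laplacian3_homog_7:
  "partial_x ((laplacian ^^ 3) (homog 7 a)) p = 5040 * a 7 + 720 * a 5 + 432 * a 3 + 720 * a 1"
  unfolding laplacian3_homog_7 by (simp add: partial_x_homog[of 0, simplified] homog_def)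

lemma partial_y_laplacian3_homog_7:
  "partial_y ((laplacian ^^ 3) (homog 7 a)) p = 720 * a 6 + 432 * a 4 + 720 * a 2 + 5040 * a 0"
  unfolding laplacian3_homog_7 by (simp add: partial_y_homog[of 0, simplified] homog_def)

text \<open>By the binomial expansion of the fourth power the numbers are 8!, 4 * 6! * 2!, 6 * 4! *
  4!, and the first two again by symmetry.\<close>

lemma laplacian4_homog_8:
  "(laplacian ^^ 4) (homog 8 a) p = 40320 * a 8 + 5760 * a 6 + 3456 * a 4 + 5760 * a 2 + 40320 * a 0"
proof -
  have "(laplacian ^^ 4) (homog 8 a) = laplacian (laplacian (laplacian (laplacian (homog 8 a))))"
    by (simp add: eval_nat_numeral)
  then show ?thesis
    using laplacian_homog[of 6] laplacian_homog[of 4] laplacian_homog[of 2] laplacian_homog[of 0]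
    by (simp add: homog_def eval_nat_numeral algebra_simps)
qed

section \<open>Perturbations of the form of degree six\<close>

lemma g6_Im: "g6 p = Im (Complex (fst p) (snd p) ^ 6)"
  by (simp add: g6_def Complex_eq split: prod.split)

lemma g6_eq: "g6 p = 6 * fst p ^ 5 * snd p - 20 * fst p ^ 3 * snd p ^ 3 + 6 * fst p * snd p ^ 5"
  unfolding g6_Im by (simp add: eval_nat_numeral algebra_simps)

lemma g6_homog: "g6 = homog 6 (\<lambda>i. if i = 1 \<or> i = 5 then 6 else if i = 3 then - 20 else 0)"
  by (rule ext) (simp add: g6_eq homog_def eval_nat_numeral algebra_simps)

text \<open>With \<open>g6y\<close> below, the partial derivatives of \<open>g6\<close>; they are
  the imaginary and real parts of \<open>6 * z ^ 5\<close>.\<close>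

definition g6x :: "real \<times> real \<Rightarrow> real" where
  "g6x p = 30 * fst p ^ 4 * snd p - 60 * fst p ^ 2 * snd p ^ 3 + 6 * snd p ^ 5"

definition g6y :: "real \<times> real \<Rightarrow> real" where
  "g6y p = 6 * fst p ^ 5 - 60 * fst p ^ 3 * snd p ^ 2 + 30 * fst p * snd p ^ 4"

text \<open>The binomial terms beyond the linear one share the factor \<open>w ^ 2\<close>. The
  constant is 57 = 15 + 20 + 15 + 6 + 1, the sum of their coefficients.\<close>

lemma norm_sixth_power_remainder:
  fixes z w :: complex
  shows "cmod ((z + w) ^ 6 - z ^ 6 - 6 * z ^ 5 * w) \<le> 57 * cmod w ^ 2 * (cmod z + cmod w) ^ 4"
proof -
  define Z where "Z = cmod z"
  define W where "W = cmod w"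
  have "(z + w) ^ 6 - z ^ 6 - 6 * z ^ 5 * w =
      w ^ 2 * (15 * z ^ 4 + 20 * z ^ 3 * w + 15 * z ^ 2 * w ^ 2 + 6 * z * w ^ 3 + w ^ 4)"
    by (simp add: eval_nat_numeral algebra_simps)
  moreover have "cmod (15 * z ^ 4 + 20 * z ^ 3 * w + 15 * z ^ 2 * w ^ 2 + 6 * z * w ^ 3 + w ^ 4)
      \<le> 15 * Z ^ 4 + 20 * Z ^ 3 * W + 15 * Z ^ 2 * W ^ 2 + 6 * Z * W ^ 3 + W ^ 4"
    unfolding Z_def W_def by (intro norm_triangle_mono) (simp_all add: norm_mult norm_power)
  moreover have "\<dots> \<le> 57 * (Z + W) ^ 4"
  proof -
    have "0 \<le> 42 * Z ^ 4 + 208 * Z ^ 3 * W + 327 * Z ^ 2 * W ^ 2 + 222 * Z * W ^ 3 + 56 * W ^ 4"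
      by (simp add: Z_def W_def)
    also have "\<dots> = 57 * (Z + W) ^ 4 -
        (15 * Z ^ 4 + 20 * Z ^ 3 * W + 15 * Z ^ 2 * W ^ 2 + 6 * Z * W ^ 3 + W ^ 4)"
      by (simp add: eval_nat_numeral algebra_simps)
    finally show ?thesis by simp
  qed
  ultimately have "cmod ((z + w) ^ 6 - z ^ 6 - 6 * z ^ 5 * w) \<le> W ^ 2 * (57 * (Z + W) ^ 4)"
    by (simp only: norm_mult norm_power W_def[symmetric]) (intro mult_left_mono, simp_all)
  then show ?thesis by (simp add: Z_def W_def mult_ac)
qed

text \<open>In complex notation only terms at least quadratic in the perturbation remain. Two
  factors of order \<open>l + 1\<close> and four of order 1 give the order
  \<open>6 + 2 * l\<close>.\<close>

lemma g6_perturb_vanishing: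
  assumes u: "u \<in> vanishing (Suc l)" and v: "v \<in> vanishing (Suc l)"
  shows "(\<lambda>p. g6 (fst p + u p, snd p + v p) - g6 p - (g6x p * u p + g6y p * v p)) \<in> vanishing (6 + 2 * l)"
proof -
  have abs_le: "cmod (Complex x y) \<le> \<bar>x\<bar> + \<bar>y\<bar>" for x y
    using cmod_le[of "Complex x y"] by simp
  let ?r = "\<lambda>p. g6 (fst p + u p, snd p + v p) - g6 p - (g6x p * u p + g6y p * v p)"
  let ?b = "\<lambda>p. (\<bar>u p\<bar> + \<bar>v p\<bar>) ^ 2 * ((\<bar>fst p\<bar> + \<bar>snd p\<bar>) + (\<bar>u p\<bar> + \<bar>v p\<bar>)) ^ 4"
  have "norm (?r p) \<le> 57 * norm (?b p)" for p
  proof -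
    let ?z = "Complex (fst p) (snd p)" and ?w = "Complex (u p) (v p)"
    have "g6 (fst p + u p, snd p + v p) = Im ((?z + ?w) ^ 6)"
      by (simp only: g6_Im fst_conv snd_conv complex_add)
    moreover have "g6x p * u p + g6y p * v p = Im (6 * ?z ^ 5 * ?w)"
      by (simp add: g6x_def g6y_def eval_nat_numeral algebra_simps)
    ultimately have "?r p = Im ((?z + ?w) ^ 6 - ?z ^ 6 - 6 * ?z ^ 5 * ?w)"
      by (simp only: g6_Im minus_complex.simps)
    then have "\<bar>?r p\<bar> \<le> cmod ((?z + ?w) ^ 6 - ?z ^ 6 - 6 * ?z ^ 5 * ?w)"
      by (simp only: abs_Im_le_cmod)
    also have "\<dots> \<le> 57 * cmod ?w ^ 2 * (cmod ?z + cmod ?w) ^ 4"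
      by (rule norm_sixth_power_remainder)
    also have "\<dots> \<le> 57 * (\<bar>u p\<bar> + \<bar>v p\<bar>) ^ 2 * ((\<bar>fst p\<bar> + \<bar>snd p\<bar>) + (\<bar>u p\<bar> + \<bar>v p\<bar>)) ^ 4"
      by (intro mult_mono power_mono add_mono abs_le) simp_all
    finally show ?thesis by simp
  qed
  then have "?r \<in> O[nhds 0](?b)"
    by (intro landau_o.bigI[of 57] always_eventually allI) simp_all
  moreover have "?b \<in> vanishing (6 + 2 * l)"
  proof -
    have uv: "(\<lambda>p. \<bar>u p\<bar> + \<bar>v p\<bar>) \<in> vanishing (Suc l)"
      using u v by (intro sum_in_bigo) simp_all
    have "(\<lambda>p. \<bar>u p\<bar> + \<bar>v p\<bar>) \<in> vanishing 1"
      using uv by (rule vanishing_mono) simp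
    moreover have "(\<lambda>p. \<bar>fst p\<bar> + \<bar>snd p\<bar>) \<in> vanishing 1"
      using fst_vanishing snd_vanishing by (intro sum_in_bigo) simp_all
    ultimately have "(\<lambda>p. (\<bar>fst p\<bar> + \<bar>snd p\<bar>) + (\<bar>u p\<bar> + \<bar>v p\<bar>)) \<in> vanishing 1"
      by (rule sum_in_bigo(1)[rotated])
    from vanishing_mult[OF vanishing_power[OF uv, of 2] vanishing_power[OF this, of 4]]
    have "?b \<in> vanishing (Suc l * 2 + 1 * 4)" .
    moreover have "Suc l * 2 + 1 * 4 = 6 + 2 * l" by simp
    ultimately show ?thesis by (simp only:)
  qed
  ultimately show ?thesis by (rule landau_o.big.trans)
qed

section \<open>Jet equivalence through coordinate changes\<close>

lemma function_germ_compose: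
  assumes "function_germ f" "smooth_on \<tau> UNIV" "\<tau> 0 = 0"
  shows "function_germ (\<lambda>p. f (\<tau> p))"
proof -
  obtain U where U: "open U" "0 \<in> U" "smooth_on f U" and f0: "f 0 = 0"
    using assms(1) unfolding function_germ_def by blast
  have preimage: "open (\<tau> -` U)"
    using smooth_on_imp_continuous_on[OF assms(2)] U(1) by (simp add: open_vimage)
  have "smooth_on (\<lambda>p. f (\<tau> p)) (\<tau> -` U)"
    by (rule smooth_on_compose[OF preimage U(1) _ U(3) smooth_on_subset[OF assms(2) subset_UNIV]]) auto
  with preimage show ?thesis
    using U(2) assms(3) f0 unfolding function_germ_def by (intro conjI exI[of _ "\<tau> -` U"]) simp_all
qed

lemma function_germ_add:
  assumes "function_germ f" "function_germ g"
  shows "function_germ (\<lambda>p. f p + g p)"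
proof -
  obtain U V where "open U" "0 \<in> U" "smooth_on f U" "open V" "0 \<in> V" "smooth_on g V"
    using assms unfolding function_germ_def by blast
  then have "open (U \<inter> V)" "0 \<in> U \<inter> V" "smooth_on (\<lambda>p. f p + g p) (U \<inter> V)"
    by (auto intro!: smooth_on_add intro: smooth_on_subset)
  then show ?thesis
    using assms unfolding function_germ_def by auto
qed

text \<open>The germ \<open>h\<close> in the new coordinates itself serves as the witness with the
  required jet. Since \<open>u\<close> and \<open>v\<close> have order 2, the coordinate change has
  the identity as derivative at the origin.\<close>

lemma R_equivalent_perturb:
  assumes "function_germ h" "function_germ h2"
    and u: "smooth_on u UNIV" "u \<in> vanishing 2" and v: "smooth_on v UNIV" "v \<in> vanishing 2"
    and diff: "(\<lambda>p. h (fst p + u p, snd p + v p) - h2 p) \<in> vanishing (Suc k)"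
  shows "R_equivalent k h h2"
proof -
  let ?\<tau> = "\<lambda>p. (fst p + u p, snd p + v p)"
  note Du = vanishing_has_derivative_zero[OF u(2)] and Dv = vanishing_has_derivative_zero[OF v(2)]
  have smooth: "smooth_on ?\<tau> UNIV"
    by (intro smooth_on_intros u v open_UNIV)
  have \<tau>0: "?\<tau> 0 = 0"
    using vanishing_imp_zero[OF u(2)] vanishing_imp_zero[OF v(2)] by (simp add: zero_prod_def)
  have "(?\<tau> has_derivative (\<lambda>h. (fst h + 0, snd h + 0))) (at 0)"
    by (intro has_derivative_Pair has_derivative_add Du Dv has_derivative_fst has_derivative_snd
        has_derivative_ident)
  then have "diffeo_germ ?\<tau>"
    using smooth \<tau>0 by (intro diffeo_germI[of UNIV]) simp_all
  moreover have germ: "function_germ (\<lambda>p. h (?\<tau> p))"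
    using assms(1) smooth \<tau>0 by (rule function_germ_compose)
  moreover have "jet k (\<lambda>p. h (?\<tau> p)) = jet k h2"
    using germ assms(2) diff by (rule jet_eqI)
  ultimately show ?thesis
    unfolding R_equivalent_def right_equivalent_def
    by (intro exI[of _ "\<lambda>p. h (?\<tau> p)"] conjI exI[of _ ?\<tau>]) auto
qed

section \<open>Linear systems for the coordinate changes\<close>

text \<open>Comparing monomials gives eight equations for six unknowns. They split by the parity of
  the power of \<open>y\<close>, and \<open>c1\<close> and \<open>c2\<close> are precisely the
  values that make the two halves consistent.\<close>

lemma degree_7_solution:
  fixes a :: "nat \<Rightarrow> real"
  defines "c1 \<equiv> 5040 * a 7 + 720 * a 5 + 432 * a 3 + 720 * a 1"
    and "c2 \<equiv> 720 * a 6 + 432 * a 4 + 720 * a 2 + 5040 * a 0"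
  obtains \<alpha> \<beta> where "\<And>p. g6x p * homog 2 \<alpha> p + g6y p * homog 2 \<beta> p + homog 7 a p =
    c1 / 5040 * fst p ^ 7 + c2 / 720 * fst p ^ 6 * snd p"
proof -
  \<comment> \<open>The end equations give \<open>v0\<close> and \<open>u2\<close>. The pairs
    \<open>u1\<close>, \<open>v2\<close> and \<open>u0\<close>, \<open>v1\<close> solve two-by-two
    systems of determinant 864 = 30^2 - 6^2. The equations containing \<open>a 3\<close> and
    \<open>a 4\<close> then hold by the choice of \<open>c1\<close> and \<open>c2\<close>.\<close>
  define b6 where "b6 = c2 / 720 - a 6"
  define v0 where "v0 = (c1 / 5040 - a 7) / 6"
  define u2 where "u2 = - a 0 / 6"
  define A where "A = 60 * v0 - a 5"
  define B where "B = 60 * u2 - a 2"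
  define u1 where "u1 = (30 * A + 6 * a 1) / 864"
  define v2 where "v2 = (- 30 * a 1 - 6 * A) / 864"
  define u0 where "u0 = (30 * b6 - 6 * B) / 864"
  define v1 where "v1 = (30 * B - 6 * b6) / 864"
  have E: "6 * v0 + a 7 = c1 / 5040" "30 * u0 + 6 * v1 + a 6 = c2 / 720"
    "30 * u1 + 6 * v2 - 60 * v0 + a 5 = 0" "30 * u2 - 60 * u0 - 60 * v1 + a 4 = 0"
    "- 60 * u1 - 60 * v2 + 30 * v0 + a 3 = 0" "- 60 * u2 + 6 * u0 + 30 * v1 + a 2 = 0"
    "6 * u1 + 30 * v2 + a 1 = 0" "6 * u2 + a 0 = 0"
    unfolding b6_def v0_def u2_def A_def B_def u1_def v2_def u0_def v1_def c1_def c2_def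
    by (simp_all add: field_simps)
  show thesis
  \<comment> \<open>The lists are reversed because \<open>u0\<close>, \<open>u1\<close>,
    \<open>u2\<close> are numbered by the power of \<open>y\<close>, while \<open>homog\<close>
    counts powers of \<open>x\<close>.\<close>
  proof (rule that[of "\<lambda>i. [u2, u1, u0] ! i" "\<lambda>i. [v2, v1, v0] ! i"])
    fix p :: "real \<times> real"
    have "g6x p * homog 2 (\<lambda>i. [u2, u1, u0] ! i) p + g6y p * homog 2 (\<lambda>i. [v2, v1, v0] ! i) p + homog 7 a p
      = (6 * v0 + a 7) * fst p ^ 7 + (30 * u0 + 6 * v1 + a 6) * fst p ^ 6 * snd p
        + (30 * u1 + 6 * v2 - 60 * v0 + a 5) * fst p ^ 5 * snd p ^ 2
        + (30 * u2 - 60 * u0 - 60 * v1 + a 4) * fst p ^ 4 * snd p ^ 3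
        + (- 60 * u1 - 60 * v2 + 30 * v0 + a 3) * fst p ^ 3 * snd p ^ 4
        + (- 60 * u2 + 6 * u0 + 30 * v1 + a 2) * fst p ^ 2 * snd p ^ 5
        + (6 * u1 + 30 * v2 + a 1) * fst p * snd p ^ 6 + (6 * u2 + a 0) * snd p ^ 7"
      by (simp add: g6x_def g6y_def homog_def eval_nat_numeral algebra_simps)
    then show "g6x p * homog 2 (\<lambda>i. [u2, u1, u0] ! i) p + g6y p * homog 2 (\<lambda>i. [v2, v1, v0] ! i) p + homog 7 a p
      = c1 / 5040 * fst p ^ 7 + c2 / 720 * fst p ^ 6 * snd p"
      unfolding E by simp
  qed
qed

text \<open>Now there are nine equations for eight unknowns, again split by parity. The half with
  even powers of \<open>y\<close> is overdetermined by one, and \<open>c\<close> makes it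
  consistent; the other half is uniquely solvable.\<close>

lemma degree_8_solution:
  fixes a :: "nat \<Rightarrow> real"
  defines "c \<equiv> 40320 * a 8 + 5760 * a 6 + 3456 * a 4 + 5760 * a 2 + 40320 * a 0"
  obtains \<alpha> \<beta> where "\<And>p. g6x p * homog 3 \<alpha> p + g6y p * homog 3 \<beta> p + homog 8 a p = c / 40320 * fst p ^ 8"
proof -
  define v0 where "v0 = (c / 40320 - a 8) / 6"
  define u3 where "u3 = - a 0 / 6"
  define A where "A = 60 * v0 - a 6"
  define B where "B = 60 * u3 - a 2"
  define u1 where "u1 = (30 * A - 6 * B) / 864"
  define v2 where "v2 = (30 * B - 6 * A) / 864"
  \<comment> \<open>Eliminating \<open>v1\<close> and \<open>u2\<close> leaves a system for
    \<open>u0\<close> and \<open>v3\<close> of determinant 36864 = 240^2 - 144^2, with right-hand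
    sides \<open>P\<close> and \<open>Q\<close>.\<close>
  define P where "P = - a 5 - 10 * a 7 + 5 * a 1"
  define Q where "Q = - a 3 - 10 * a 1 + 5 * a 7"
  define u0 where "u0 = (240 * P + 144 * Q) / 36864"
  define v3 where "v3 = (240 * Q + 144 * P) / 36864"
  define v1 where "v1 = - a 7 / 6 - 5 * u0"
  define u2 where "u2 = - a 1 / 6 - 5 * v3"
  have E: "6 * v0 + a 8 = c / 40320" "30 * u0 + 6 * v1 + a 7 = 0"
    "30 * u1 - 60 * v0 + 6 * v2 + a 6 = 0" "30 * u2 - 60 * u0 - 60 * v1 + 6 * v3 + a 5 = 0"
    "30 * u3 - 60 * u1 + 30 * v0 - 60 * v2 + a 4 = 0" "- 60 * u2 + 6 * u0 + 30 * v1 - 60 * v3 + a 3 = 0"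
    "- 60 * u3 + 6 * u1 + 30 * v2 + a 2 = 0" "6 * u2 + 30 * v3 + a 1 = 0" "6 * u3 + a 0 = 0"
    unfolding v1_def u2_def u0_def v3_def P_def Q_def u1_def v2_def A_def B_def v0_def u3_def c_def
    by (simp_all add: field_simps)
  show thesis
  proof (rule that[of "\<lambda>i. [u3, u2, u1, u0] ! i" "\<lambda>i. [v3, v2, v1, v0] ! i"])
    fix p :: "real \<times> real"
    have "g6x p * homog 3 (\<lambda>i. [u3, u2, u1, u0] ! i) p + g6y p * homog 3 (\<lambda>i. [v3, v2, v1, v0] ! i) p
        + homog 8 a p
      = (6 * v0 + a 8) * fst p ^ 8 + (30 * u0 + 6 * v1 + a 7) * fst p ^ 7 * snd p
        + (30 * u1 - 60 * v0 + 6 * v2 + a 6) * fst p ^ 6 * snd p ^ 2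
        + (30 * u2 - 60 * u0 - 60 * v1 + 6 * v3 + a 5) * fst p ^ 5 * snd p ^ 3
        + (30 * u3 - 60 * u1 + 30 * v0 - 60 * v2 + a 4) * fst p ^ 4 * snd p ^ 4
        + (- 60 * u2 + 6 * u0 + 30 * v1 - 60 * v3 + a 3) * fst p ^ 3 * snd p ^ 5
        + (- 60 * u3 + 6 * u1 + 30 * v2 + a 2) * fst p ^ 2 * snd p ^ 6
        + (6 * u2 + 30 * v3 + a 1) * fst p * snd p ^ 7 + (6 * u3 + a 0) * snd p ^ 8"
      by (simp add: g6x_def g6y_def homog_def eval_nat_numeral algebra_simps)
    then show "g6x p * homog 3 (\<lambda>i. [u3, u2, u1, u0] ! i) p + g6y p * homog 3 (\<lambda>i. [v3, v2, v1, v0] ! i) p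
        + homog 8 a p = c / 40320 * fst p ^ 8"
      unfolding E by simp
  qed
qed

section \<open>Normal forms\<close>

text \<open>Harmonicity is a recursion linking \<open>a i\<close> and \<open>a (i + 2)\<close>, so
  \<open>a 6\<close> and \<open>a 5\<close> determine the form. Comparing the coefficients of
  \<open>x ^ 6\<close> and \<open>x ^ 5 * y\<close> yields the complex factor.\<close>

lemma harmonic_homog_6:
  assumes "harmonic (homog 6 a)"
  shows "homog 6 a p = Re (Complex (a 6) (- a 5 / 6) * Complex (fst p) (snd p) ^ 6)"
proof -
  note E = homog_eq_zero_imp[OF assms[unfolded harmonic_def laplacian_homog_6, rule_format]]
  have "a 4 = - 15 * a 6" "a 2 = 15 * a 6" "a 0 = - a 6" "a 3 = - 10 / 3 * a 5" "a 1 = a 5"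
    using E[of 4] E[of 3] E[of 2] E[of 1] E[of 0] by (simp_all add: eval_nat_numeral)
  then show ?thesis
    by (simp add: homog_def eval_nat_numeral algebra_simps)
qed

lemma conformally_right_equivalent_g6:
  assumes h: "\<forall>\<^sub>F p in nhds 0. h p = Re (\<alpha> * Complex (fst p) (snd p) ^ 6) + R p"
    and "\<alpha> \<noteq> 0" and R: "function_germ R" "R \<in> vanishing 7"
  shows "\<exists>R'. function_germ R' \<and> R' \<in> vanishing 7 \<and>
    conformally_right_equivalent h (\<lambda>p. g6 p + R' p)"
proof -
  \<comment> \<open>A sixth root of \<open>- \<i> / \<alpha>\<close>, chosen because
    \<open>Re (- \<i> * z ^ 6)\<close> is \<open>g6\<close>.\<close>
  define b where "b = exp (Ln (- \<i> / \<alpha>) / 6)"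
  have "b \<noteq> 0" by (simp add: b_def)
  have "b ^ 6 = exp (6 * (Ln (- \<i> / \<alpha>) / 6))"
    by (simp only: b_def exp_of_nat_mult[symmetric]) simp
  then have b6: "\<alpha> * b ^ 6 = - \<i>"
    using \<open>\<alpha> \<noteq> 0\<close> by (simp add: exp_Ln)
  \<comment> \<open>Multiplication by a complex number in real coordinates. The inverse map is
    multiplication by \<open>inverse b\<close>.\<close>
  define T where "T b p = (Re b * fst p + (- Im b) * snd p, Im b * fst p + Re b * snd p)"
    for b and p :: "real \<times> real"
  have T: "Complex (fst (T b p)) (snd (T b p)) = b * Complex (fst p) (snd p)" for b p
    by (simp add: T_def complex_eq_iff)
  have eqI: "p = q" if "Complex (fst p) (snd p) = Complex (fst q) (snd q)" for p q
    using that by (simp add: prod_eq_iff)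
  have smooth: "smooth_on (T b) UNIV" for b
    unfolding T_def[abs_def] by (intro smooth_on_intros open_UNIV)
  have inv: "T (inverse b) (T b p) = p" "T b (T (inverse b) p) = p" for p
    by (rule eqI, simp add: T \<open>b \<noteq> 0\<close>)+
  have T0: "T b 0 = 0" for b
    by (simp add: T_def zero_prod_def)
  have "surj (T b)"
    using inv(2) by (metis surjI)
  then have diffeo: "diffeo_germ (T b)"
    unfolding diffeo_germ_def
    by (intro conjI T0 exI[of _ UNIV] exI[of _ "T (inverse b)"]) (simp_all add: smooth inv)
  have lin: "linear (T b)" for b
    by (rule linearI) (simp_all add: T_def algebra_simps)
  have norm_T: "norm (T b p) = cmod b * norm p" for b p
  proof -
    have "norm q = cmod (Complex (fst q) (snd q))" for q
      by (cases q) (simp add: norm_Pair cmod_def)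
    then show ?thesis by (simp add: T norm_mult)
  qed
  \<comment> \<open>Multiplication by \<open>b\<close> is an isometry scaled by
    \<open>cmod b\<close>; being linear, it is its own derivative everywhere, hence
    conformal.\<close>
  have "orthogonal_transformation (\<lambda>v. inverse (cmod b) *\<^sub>R T b v)"
    unfolding orthogonal_transformation
    using \<open>b \<noteq> 0\<close> by (simp add: norm_T linear_compose_scale_right lin)
  moreover have "(T b has_derivative (\<lambda>v. cmod b *\<^sub>R inverse (cmod b) *\<^sub>R T b v)) (at p)" for p
    using \<open>b \<noteq> 0\<close> lin[of b]
    by (simp add: linear_imp_has_derivative)
  ultimately have conformal: "conformal_germ (T b)"
    unfolding conformal_germ_def using \<open>b \<noteq> 0\<close>
    by (intro always_eventually allI exI[of _ "cmod b"] exI[of _ "\<lambda>v. inverse (cmod b) *\<^sub>R T b v"]) simp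
  have lim: "(T b \<longlongrightarrow> T b 0) (nhds 0)"
    unfolding T_def
    by (intro tendsto_Pair tendsto_add tendsto_mult tendsto_const tendsto_fst tendsto_snd filterlim_ident)
  have lim: "filterlim (T b) (nhds 0) (nhds 0)"
    using lim by (simp only: T0)
  have "\<forall>\<^sub>F p in nhds 0. h (T b p) = g6 p + R (T b p)"
    using eventually_compose_filterlim[OF h lim]
  proof (rule eventually_mono)
    fix p
    assume "h (T b p) = Re (\<alpha> * Complex (fst (T b p)) (snd (T b p)) ^ 6) + R (T b p)"
    moreover have "\<alpha> * Complex (fst (T b p)) (snd (T b p)) ^ 6 = - \<i> * Complex (fst p) (snd p) ^ 6"
      by (simp only: T power_mult_distrib mult.assoc[symmetric] b6)
    ultimately show "h (T b p) = g6 p + R (T b p)"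
      by (simp add: g6_Im)
  qed
  moreover have "(\<lambda>p. R (T b p)) \<in> vanishing 7"
    unfolding T_def
    by (intro vanishing_compose R(2) sum_in_bigo)
      (use vanishing_mult[OF const_vanishing fst_vanishing] vanishing_mult[OF const_vanishing snd_vanishing] in simp_all)
  moreover have "function_germ (\<lambda>p. R (T b p))"
    by (rule function_germ_compose[OF R(1) smooth T0])
  ultimately show ?thesis
    unfolding conformally_right_equivalent_def using diffeo conformal by blast
qed

text \<open>Under a quadratic perturbation the nonlinear error of \<open>g6\<close>, the change of
  the form of degree 7, and \<open>R\<close> all have order 8. Only the linear term is visible in
  the 7-jet, and \<open>degree_7_solution\<close> adjusts it.\<close>

lemma R_7_normal_form:
  assumes R: "function_germ R" "R \<in> vanishing 8"
    and c1: "c1 = 5040 * a 7 + 720 * a 5 + 432 * a 3 + 720 * a 1"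
    and c2: "c2 = 720 * a 6 + 432 * a 4 + 720 * a 2 + 5040 * a 0"
  shows "R_equivalent 7 (\<lambda>p. g6 p + homog 7 a p + R p)
    (\<lambda>(x, y). g6 (x, y) + c1 / fact 7 * x ^ 7 + c2 / (fact 6 * fact 1) * x ^ 6 * y)"
proof -
  let ?b = "\<lambda>i. if i = 7 then c1 / 5040 else if i = 6 then c2 / 720 else 0"
  have b: "homog 7 ?b p = c1 / 5040 * fst p ^ 7 + c2 / 720 * fst p ^ 6 * snd p" for p
    by (simp add: homog_def eval_nat_numeral)
  have target: "(\<lambda>(x, y). g6 (x, y) + c1 / fact 7 * x ^ 7 + c2 / (fact 6 * fact 1) * x ^ 6 * y)
      = (\<lambda>p. g6 p + homog 7 ?b p)"
    unfolding b by (simp add: fun_eq_iff fact_numeral)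
  obtain \<alpha> \<beta> where "\<And>p. g6x p * homog 2 \<alpha> p + g6y p * homog 2 \<beta> p + homog 7 a p = c1 / 5040 * fst p ^ 7 + c2 / 720 * fst p ^ 6 * snd p"
    by (rule degree_7_solution[of a, folded c1 c2]) (rule that)
  then have sol: "g6x p * homog 2 \<alpha> p + g6y p * homog 2 \<beta> p + homog 7 a p = homog 7 ?b p" for p
    by (simp only: b)
  let ?u = "homog 2 \<alpha>" and ?v = "homog 2 \<beta>"
  have uv: "?u \<in> vanishing (Suc 1)" "?v \<in> vanishing (Suc 1)"
    using homog_vanishing[of 2] by (simp_all add: numeral_2_eq_2)
  have "function_germ g6"
    unfolding g6_homog by (rule function_germ_homog) simp
  note germ = function_germ_add[OF function_germ_add[OF this function_germ_homog[of 7 a]] R(1)]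
    function_germ_add[OF this function_germ_homog[of 7 ?b]]
  have shift: "(\<lambda>p. fst p + ?u p) \<in> vanishing 1" "(\<lambda>p. snd p + ?v p) \<in> vanishing 1"
    by (intro sum_in_bigo(1) fst_vanishing snd_vanishing vanishing_mono[OF uv(1)] vanishing_mono[OF uv(2)]; simp)+
  show ?thesis
    unfolding target
  proof (rule R_equivalent_perturb[where u = ?u and v = ?v])
    have deg: "6 + 2 * 1 = (8::nat)" "7 + 1 = (8::nat)" "Suc 7 = (8::nat)" by simp_all
    have "(\<lambda>p. (g6 (fst p + ?u p, snd p + ?v p) - g6 p - (g6x p * ?u p + g6y p * ?v p))
        + (homog 7 a (fst p + ?u p, snd p + ?v p) - homog 7 a p)
        + R (fst p + ?u p, snd p + ?v p)) \<in> vanishing 8"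
      by (rule sum_in_bigo(1)[OF sum_in_bigo(1)[OF g6_perturb_vanishing[OF uv, unfolded deg]
              homog_perturb_vanishing[OF uv, of 7 a, unfolded deg]] vanishing_compose[OF R(2) shift]])
    moreover have "g6 (fst p + ?u p, snd p + ?v p) + homog 7 a (fst p + ?u p, snd p + ?v p)
        + R (fst p + ?u p, snd p + ?v p) - (g6 p + homog 7 ?b p)
      = (g6 (fst p + ?u p, snd p + ?v p) - g6 p - (g6x p * ?u p + g6y p * ?v p))
        + (homog 7 a (fst p + ?u p, snd p + ?v p) - homog 7 a p)
        + R (fst p + ?u p, snd p + ?v p)" for p
      using sol[of p] by linarith
    ultimately show "(\<lambda>p. g6 (fst p + ?u p, snd p + ?v p) + homog 7 a (fst p + ?u p, snd p + ?v p)
        + R (fst p + ?u p, snd p + ?v p) - (g6 p + homog 7 ?b p)) \<in> vanishing (Suc 7)"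
      by (simp only: deg)
  qed (simp_all add: germ smooth_on_homog homog_vanishing)
qed

text \<open>A cubic perturbation changes the form of degree 7 only from order 9 on, so that form
  survives in the 8-jet. The nonlinear error of \<open>g6\<close> and the change of the form of
  degree 8 have order 10.\<close>

lemma R_8_normal_form:
  assumes c: "c = 40320 * a 8 + 5760 * a 6 + 3456 * a 4 + 5760 * a 2 + 40320 * a 0"
  shows "R_equivalent 8 (\<lambda>p. g6 p + homog 7 r p + homog 8 a p)
    (\<lambda>(x, y). g6 (x, y) + homog 7 r (x, y) + c / fact 8 * x ^ 8)"
proof -
  let ?b = "\<lambda>i. if i = 8 then c / 40320 else 0"
  have b: "homog 8 ?b p = c / 40320 * fst p ^ 8" for p
    by (simp add: homog_def eval_nat_numeral)
  have target: "(\<lambda>(x, y). g6 (x, y) + homog 7 r (x, y) + c / fact 8 * x ^ 8)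
      = (\<lambda>p. g6 p + homog 7 r p + homog 8 ?b p)"
    unfolding b by (simp add: fun_eq_iff fact_numeral)
  obtain \<alpha> \<beta> where "\<And>p. g6x p * homog 3 \<alpha> p + g6y p * homog 3 \<beta> p + homog 8 a p = c / 40320 * fst p ^ 8"
    by (rule degree_8_solution[of a, folded c]) (rule that)
  then have sol: "g6x p * homog 3 \<alpha> p + g6y p * homog 3 \<beta> p + homog 8 a p = homog 8 ?b p" for p
    by (simp only: b)
  let ?u = "homog 3 \<alpha>" and ?v = "homog 3 \<beta>"
  have uv: "?u \<in> vanishing (Suc 2)" "?v \<in> vanishing (Suc 2)"
    using homog_vanishing[of 3] by (simp_all add: numeral_3_eq_3 numeral_2_eq_2)
  have "function_germ g6"
    unfolding g6_homog by (rule function_germ_homog) simp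
  note germ = function_germ_add[OF function_germ_add[OF this function_germ_homog[of 7 r]] function_germ_homog[of 8]]
  show ?thesis
    unfolding target
  proof (rule R_equivalent_perturb[where u = ?u and v = ?v])
    have deg: "7 + 2 = (9::nat)" "Suc 8 = (9::nat)" by simp_all
    have "(\<lambda>p. (g6 (fst p + ?u p, snd p + ?v p) - g6 p - (g6x p * ?u p + g6y p * ?v p))
        + (homog 7 r (fst p + ?u p, snd p + ?v p) - homog 7 r p)
        + (homog 8 a (fst p + ?u p, snd p + ?v p) - homog 8 a p)) \<in> vanishing 9"
      by (rule sum_in_bigo(1)[OF sum_in_bigo(1)[OF vanishing_mono[OF g6_perturb_vanishing[OF uv]]
              homog_perturb_vanishing[OF uv, of 7 r, unfolded deg]]
            vanishing_mono[OF homog_perturb_vanishing[OF uv]]]) simp_all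
    moreover have "g6 (fst p + ?u p, snd p + ?v p) + homog 7 r (fst p + ?u p, snd p + ?v p)
        + homog 8 a (fst p + ?u p, snd p + ?v p) - (g6 p + homog 7 r p + homog 8 ?b p)
      = (g6 (fst p + ?u p, snd p + ?v p) - g6 p - (g6x p * ?u p + g6y p * ?v p))
        + (homog 7 r (fst p + ?u p, snd p + ?v p) - homog 7 r p)
        + (homog 8 a (fst p + ?u p, snd p + ?v p) - homog 8 a p)" for p
      using sol[of p] by linarith
    ultimately show "(\<lambda>p. g6 (fst p + ?u p, snd p + ?v p) + homog 7 r (fst p + ?u p, snd p + ?v p)
        + homog 8 a (fst p + ?u p, snd p + ?v p) - (g6 p + homog 7 r p + homog 8 ?b p)) \<in> vanishing (Suc 8)"
      by (simp only: deg)
    show "?u \<in> vanishing 2" "?v \<in> vanishing 2"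
      using uv by (auto intro: vanishing_mono)
  qed (simp_all add: germ smooth_on_homog)
qed

theorem theorem2:
  shows
    "(\<forall>h h6 R7.
        function_germ h \<and> (\<forall>\<^sub>F p in nhds 0. h p = h6 p + R7 p) \<and>
        homogeneous_poly 6 h6 \<and> h6 \<noteq> (\<lambda>p. 0) \<and> harmonic h6 \<and>
        function_germ R7 \<and> germ_order R7 \<ge> 7 \<longrightarrow>
        (\<exists>R7'. function_germ R7' \<and> germ_order R7' \<ge> 7 \<and>
           conformally_right_equivalent h (\<lambda>p. g6 p + R7' p)))
     \<and>
     (\<forall>\<rho>7 R8.
        homogeneous_poly 7 \<rho>7 \<and> function_germ R8 \<and> germ_order R8 \<ge> 8 \<longrightarrow>
        (\<exists>c1 c2 :: real.
           (\<forall>p. partial_x ((laplacian ^^ 3) \<rho>7) p = c1) \<and>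
           (\<forall>p. partial_y ((laplacian ^^ 3) \<rho>7) p = c2) \<and>
           R_equivalent 7 (\<lambda>p. g6 p + \<rho>7 p + R8 p)
             (\<lambda>(x, y). g6 (x, y) + c1 / fact 7 * x ^ 7 + c2 / (fact 6 * fact 1) * x ^ 6 * y)))
     \<and>
     (\<forall>\<rho>7 \<rho>8.
        homogeneous_poly 7 \<rho>7 \<and> homogeneous_poly 8 \<rho>8 \<longrightarrow>
        (\<exists>c :: real.
           (\<forall>p. (laplacian ^^ 4) \<rho>8 p = c) \<and>
           R_equivalent 8 (\<lambda>p. g6 p + \<rho>7 p + \<rho>8 p)
             (\<lambda>(x, y). g6 (x, y) + \<rho>7 (x, y) + c / fact 8 * x ^ 8)))"
proof (intro conjI allI impI; (elim conjE)?)
  fix h h6 R7 :: "real \<times> real \<Rightarrow> real"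
  assume h: "\<forall>\<^sub>F p in nhds 0. h p = h6 p + R7 p" and "homogeneous_poly 6 h6" "h6 \<noteq> (\<lambda>p. 0)"
    "harmonic h6" and R: "function_germ R7" "germ_order R7 \<ge> 7"
  then obtain a where a: "h6 = homog 6 a" and "harmonic (homog 6 a)"
    by (auto simp: homogeneous_poly_iff)
  note h6 = harmonic_homog_6[OF this(2)]
  let ?\<alpha> = "Complex (a 6) (- a 5 / 6)"
  \<comment> \<open>By \<open>harmonic_homog_6\<close> a zero factor would make the whole form
    vanish.\<close>
  have "?\<alpha> \<noteq> 0"
  proof
    assume "?\<alpha> = 0"
    then have "homog 6 a p = 0" for p
      unfolding h6 by (simp only: mult_zero_left zero_complex.sel)
    with a \<open>h6 \<noteq> (\<lambda>p. 0)\<close> show False by (simp add: fun_eq_iff)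
  qed
  moreover have "R7 \<in> vanishing 7"
    using R germ_order_ge_iff[of R7 7] by (simp add: numeral_eq_enat)
  ultimately obtain R' where "function_germ R'" "R' \<in> vanishing 7"
    "conformally_right_equivalent h (\<lambda>p. g6 p + R' p)"
    using conformally_right_equivalent_g6[OF h[unfolded a h6] _ R(1)] by blast
  then show "\<exists>R7'. function_germ R7' \<and> germ_order R7' \<ge> 7 \<and>
      conformally_right_equivalent h (\<lambda>p. g6 p + R7' p)"
    using germ_order_ge_iff[of R' 7] by (auto simp: numeral_eq_enat)
next
  fix \<rho>7 R8 :: "real \<times> real \<Rightarrow> real"
  assume "homogeneous_poly 7 \<rho>7" and R: "function_germ R8" "germ_order R8 \<ge> 8"
  then obtain a where a: "\<rho>7 = homog 7 a" by (auto simp: homogeneous_poly_iff)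
  have "R8 \<in> vanishing 8"
    using R germ_order_ge_iff[of R8 8] by (simp add: numeral_eq_enat)
  from R_7_normal_form[OF R(1) this refl refl, of a]
  show "\<exists>c1 c2. (\<forall>p. partial_x ((laplacian ^^ 3) \<rho>7) p = c1) \<and>
      (\<forall>p. partial_y ((laplacian ^^ 3) \<rho>7) p = c2) \<and>
      R_equivalent 7 (\<lambda>p. g6 p + \<rho>7 p + R8 p)
        (\<lambda>(x, y). g6 (x, y) + c1 / fact 7 * x ^ 7 + c2 / (fact 6 * fact 1) * x ^ 6 * y)"
    unfolding a using partial_x_laplacian3_homog_7 partial_y_laplacian3_homog_7 by blast
next
  fix \<rho>7 \<rho>8 :: "real \<times> real \<Rightarrow> real"
  assume "homogeneous_poly 7 \<rho>7" "homogeneous_poly 8 \<rho>8"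
  then obtain r a where ra: "\<rho>7 = homog 7 r" "\<rho>8 = homog 8 a" by (auto simp: homogeneous_poly_iff)
  from R_8_normal_form[OF refl, of r a]
  show "\<exists>c. (\<forall>p. (laplacian ^^ 4) \<rho>8 p = c) \<and>
      R_equivalent 8 (\<lambda>p. g6 p + \<rho>7 p + \<rho>8 p)
        (\<lambda>(x, y). g6 (x, y) + \<rho>7 (x, y) + c / fact 8 * x ^ 8)"
    unfolding ra using laplacian4_homog_8 by blast
qed

end
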